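(* Let $d\geq 2$, let $H$ be a finite graph and $G_H$ its body-hinge graph in $\mathbb{R}^d$. Let $D=\binom{d+1}{2}$. If for every $e\in E(H)$ the multigraph $(D-1)(H-e)+(D-3)e$ contains $D$ edge-disjoint spanning trees, then $G_H$ is globally rigid in $\mathbb{R}^d$.
   Context: The body-hinge graph $G_H=(V_H,E_H)$ of a graph $H$ in $\mathbb{R}^d$ has vertex set $V_H=\bigcup_{v\in V(H)}B_v\cup\bigcup_{e\in E(H)}H_e$, where $B_v=\{v_1,\dots,v_{d+1}\}$ and $H_e=\{h_{e,1},\dots,h_{e,d-1}\}$ are pairwise disjoint new vertex sets, and edge set consisting of all edges of the complete graph on each $B_v$, together with, for each $v\in V(H)$ and each edge $e$ of $H$ incident to $v$, all edges between $B_v$ and $H_e$. For a positive integer $k$, $k(H-e)+je$ denotes the multigraph on $V(H)$ in which each edge $f\neq e$ of $H$ is replaced by $k$ parallel copies and $e$ by $j$ parallel copies. A framework $(G,\mathbf{p})$ in $\mathbb{R}^d$ is globally rigid if every $\mathbf{q}$ with $\|q_u-q_v\|=\|p_u-p_v\|$ for all edges $uv$ satisfies this for all vertex pairs; $\mathbf{p}$ is generic if its coordinates are algebraically independent over $\mathbb{Q}$; a graph is globally rigid in $\mathbb{R}^d$ if some (equivalently every) generic realization of it is globally rigid.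
   Formalization: It is additionally assumed that H has at least one edge or at most one vertex; for an edgeless H with two or more vertices the hypothesis is vacuous and G_H, a disjoint union of complete graphs, is not globally rigid. *)

theory Defs
  imports "HOL-Analysis.Analysis" "HOL-Library.Poly_Mapping" "HOL-Library.Disjoint_Sets"
begin

section \<open>Multigraphs and edge-disjoint spanning trees\<close>

text \<open>Undirected multigraphs: edges have an identity of their own, and \<open>ends e\<close> is the set of
  end vertices of \<open>e\<close>.  Parallel edges are allowed, loops are not.  Simple graphs are the case
  where \<open>ends\<close> is injective on the edges.\<close>

record ('v, 'e) multigraph =
  verts :: "'v set"
  edges :: "'e set"
  ends :: "'e \<Rightarrow> 'v set"

definition finite_multigraph :: "('v, 'e) multigraph \<Rightarrow> bool" where
  "finite_multigraph H \<longleftrightarrow> finite (verts H) \<and> finite (edges H) \<and>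
     (\<forall>e\<in>edges H. ends H e \<subseteq> verts H \<and> card (ends H e) = 2)"

text \<open>The multigraph \<open>k(H - e) + je\<close>; the pair \<open>(f, i)\<close> is the \<open>i\<close>-th copy of \<open>f\<close>.\<close>

definition multiply_edges ::
    "nat \<Rightarrow> nat \<Rightarrow> ('v, 'e) multigraph \<Rightarrow> 'e \<Rightarrow> ('v, 'e \<times> nat) multigraph" where
  "multiply_edges k j H e =
     \<lparr>verts = verts H,
      edges = {(f, i). f \<in> edges H \<and> i < (if f = e then j else k)},
      ends = (\<lambda>(f, i). ends H f)\<rparr>"

definition connected_by :: "('v, 'e) multigraph \<Rightarrow> 'e set \<Rightarrow> bool" where
  "connected_by M T \<longleftrightarrow>
     (\<forall>u\<in>verts M. \<forall>v\<in>verts M. (u, v) \<in> {(x, y). \<exists>e\<in>T. ends M e = {x, y}}\<^sup>*)"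

text \<open>A cycle is given by its vertices and edges in cyclic order; length 2 means a pair of
  parallel edges.\<close>

definition is_cycle :: "('v, 'e) multigraph \<Rightarrow> 'v list \<Rightarrow> 'e list \<Rightarrow> bool" where
  "is_cycle M vs es \<longleftrightarrow>
     es \<noteq> [] \<and> length vs = length es \<and> distinct vs \<and> distinct es \<and>
     (\<forall>i<length es. ends M (es ! i) = {vs ! i, vs ! (Suc i mod length es)})"

definition spanning_tree :: "('v, 'e) multigraph \<Rightarrow> 'e set \<Rightarrow> bool" where
  "spanning_tree M T \<longleftrightarrow>
     T \<subseteq> edges M \<and> connected_by M T \<and> \<not> (\<exists>vs es. set es \<subseteq> T \<and> is_cycle M vs es)"

text \<open>The trees are indexed because for a one-vertex multigraph they all have an empty edge set.\<close>

definition has_disjoint_spanning_trees :: "nat \<Rightarrow> ('v, 'e) multigraph \<Rightarrow> bool" where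
  "has_disjoint_spanning_trees n M \<longleftrightarrow>
     (\<exists>T. (\<forall>i<n. spanning_tree M (T i)) \<and> disjoint_family_on T {..<n})"


section \<open>Body-hinge graphs\<close>

datatype ('v, 'e) bh_vertex = Body 'v nat | Hinge 'e nat

definition bh_verts :: "nat \<Rightarrow> ('v, 'e) multigraph \<Rightarrow> ('v, 'e) bh_vertex set" where
  "bh_verts d H =
     {Body v i |v i. v \<in> verts H \<and> i \<in> {1..d+1}} \<union>
     {Hinge e j |e j. e \<in> edges H \<and> j \<in> {1..d-1}}"

definition bh_edges :: "nat \<Rightarrow> ('v, 'e) multigraph \<Rightarrow> ('v, 'e) bh_vertex set set" where
  "bh_edges d H =
     {{Body v i, Body v j} |v i j. v \<in> verts H \<and> i \<in> {1..d+1} \<and> j \<in> {1..d+1} \<and> i \<noteq> j} \<union>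
     {{Body v i, Hinge e j} |v e i j.
        v \<in> verts H \<and> e \<in> edges H \<and> v \<in> ends H e \<and> i \<in> {1..d+1} \<and> j \<in> {1..d-1}}"


section \<open>Generic global rigidity\<close>

text \<open>A rational polynomial in the variables \<open>'i\<close> is a finitely supported map from monomials to
  coefficients, a monomial being a finitely supported map from variables to exponents.\<close>

definition eval_poly :: "('i \<Rightarrow> real) \<Rightarrow> (('i \<Rightarrow>\<^sub>0 nat) \<Rightarrow>\<^sub>0 rat) \<Rightarrow> real" where
  "eval_poly x P =
     (\<Sum>m\<in>Poly_Mapping.keys P. of_rat (Poly_Mapping.lookup P m) *
        (\<Prod>i\<in>Poly_Mapping.keys m. x i ^ Poly_Mapping.lookup m i))"

definition alg_independent_over_rat :: "'i set \<Rightarrow> ('i \<Rightarrow> real) \<Rightarrow> bool" where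
  "alg_independent_over_rat I x \<longleftrightarrow>
     (\<forall>P. (\<forall>m\<in>Poly_Mapping.keys P. Poly_Mapping.keys m \<subseteq> I) \<longrightarrow> eval_poly x P = 0 \<longrightarrow> P = 0)"

definition generic_realization :: "'w set \<Rightarrow> ('w \<Rightarrow> real ^ 'd) \<Rightarrow> bool" where
  "generic_realization W p \<longleftrightarrow> alg_independent_over_rat (W \<times> UNIV) (\<lambda>(w, i). p w $ i)"

text \<open>A simple graph is given by its vertex set \<open>W\<close> and its set \<open>F\<close> of two-element edges.\<close>

definition globally_rigid_framework ::
    "'w set \<Rightarrow> 'w set set \<Rightarrow> ('w \<Rightarrow> real ^ 'd) \<Rightarrow> bool" where
  "globally_rigid_framework W F p \<longleftrightarrow>
     (\<forall>q :: 'w \<Rightarrow> real ^ 'd.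
        (\<forall>u v. {u, v} \<in> F \<longrightarrow> norm (q u - q v) = norm (p u - p v)) \<longrightarrow>
        (\<forall>u\<in>W. \<forall>v\<in>W. norm (q u - q v) = norm (p u - p v)))"

text \<open>The dimension is \<open>CARD('d)\<close>.  Global rigidity is a generic property, so "some generic
  realization" and "every generic realization" define the same graphs.\<close>

definition globally_rigid_graph :: "'d::finite itself \<Rightarrow> 'w set \<Rightarrow> 'w set set \<Rightarrow> bool" where
  "globally_rigid_graph _ W F \<longleftrightarrow>
     (\<exists>p :: 'w \<Rightarrow> real ^ 'd. generic_realization W p \<and> globally_rigid_framework W F p)"

end

theory Submission
  imports Defs "HOL-Computational_Algebra.Polynomial"
begin

text \<open>Let \<open>h\<close> be a hinge vertex between the bodies \<open>u\<close> and \<open>v\<close>. If the framework without \<open>h\<close> is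
  rigid and generic, then it has only finitely many equivalent realizations with \<open>u\<close> held fixed, and a
  generic position of \<open>h\<close> lies on none of the hyperplanes that would let \<open>v\<close> be at a wrong one of
  them. Hence any equivalent realization is congruent on \<open>u \<union> v\<close>, so that \<open>h\<close> may be traded for the
  complete graph on \<open>u \<union> v\<close>. Doing this once for each edge of \<open>H\<close> leaves a graph which is globally
  rigid because \<open>H\<close> is connected.

  Finiteness is proved by counting transcendence degrees over \<open>\<rat>\<close>: at a generic point the edge lengths
  of a rigid framework have full transcendence degree, hence the coordinates of every equivalent
  realization are algebraic over them. Rigidity after deleting \<open>h\<close> is seen in a special position in
  which all bodies coincide with one simplex. The \<open>D\<close> spanning trees correspond to the \<open>D\<close> edges of the
  simplex, and the tree of an edge forces the bodies to move alike along that edge.\<close>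

text \<open>The numbers \<open>D - 1\<close> and \<open>D - 3\<close> count constraints. A full
  hinge leaves its two bodies one relative degree of freedom; without one of its
  \<open>d - 1\<close> hinge vertices it leaves three, the rotations about a flat of dimension
  \<open>d - 3\<close>. In the simplex model these are the single edge, respectively the three edges
  of the triangle, that avoid the hinge vertices. The special position may be so degenerate because
  rigidity is used only as injectivity of the derivative of the edge lengths. Its failure is a
  condition on polynomials in the coordinates, so injectivity at one point gives it at every generic
  point. Rigidity alone leaves alternative positions open, and an alternative need not be generic.
  What saves the argument is that the list of alternatives is finite and fixed before
  \<open>h\<close> is placed, so that \<open>h\<close> can be generic relative to all of their
  coordinates. The graph is therefore built in the reverse of the elimination order: hinge vertices
  are put back one at a time, each chosen after all coordinates present at that stage.\<close>

section \<open>Polynomial functions and generic points\<close>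

text \<open>Polynomial functions, not formal polynomials. \<open>K\<close> is a bare set of
  constants without closure conditions, so that any countable set of reals can serve, and the index
  type is free, so that a set of functions can itself be the set of variables.\<close>

inductive_set polys :: "real set \<Rightarrow> 'i set \<Rightarrow> (('i \<Rightarrow> real) \<Rightarrow> real) set" for K I where
  polys_const: "c \<in> K \<Longrightarrow> (\<lambda>x. c) \<in> polys K I"
| polys_var: "i \<in> I \<Longrightarrow> (\<lambda>x. x i) \<in> polys K I"
| polys_add: "f \<in> polys K I \<Longrightarrow> g \<in> polys K I \<Longrightarrow> (\<lambda>x. f x + g x) \<in> polys K I"
| polys_mult: "f \<in> polys K I \<Longrightarrow> g \<in> polys K I \<Longrightarrow> (\<lambda>x. f x * g x) \<in> polys K I"

text \<open>Algebraic independence of the coordinates in \<open>I\<close> over the constants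
  \<open>K\<close>. With a set \<open>S\<close> of functions as index set and
  \<open>\<lambda>s. s p\<close> as the point it says that the values of these functions at
  \<open>p\<close> are algebraically independent.\<close>

definition generic_point :: "real set \<Rightarrow> 'i set \<Rightarrow> ('i \<Rightarrow> real) \<Rightarrow> bool" where
  "generic_point K I x \<longleftrightarrow> (\<forall>g\<in>polys K I. g x = 0 \<longrightarrow> (\<forall>z. g z = 0))"

lemma polys_cong: "f \<in> polys K I \<Longrightarrow> (\<And>i. i \<in> I \<Longrightarrow> x i = y i) \<Longrightarrow> f x = f y"
  by (induction rule: polys.induct) auto

lemma polys_sum:
  assumes "0 \<in> K" "\<And>s. s \<in> S \<Longrightarrow> f s \<in> polys K I"
  shows "(\<lambda>x. \<Sum>s\<in>S. f s x) \<in> polys K I"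
  using assms(2)
proof (induction S rule: infinite_finite_induct)
  case (insert s S)
  then show ?case by (simp add: polys_add)
qed (use assms(1) in \<open>auto intro: polys_const\<close>)

lemma polys_power:
  assumes "1 \<in> K" "f \<in> polys K I"
  shows "(\<lambda>x. f x ^ n) \<in> polys K I"
  by (induction n) (auto intro: polys.intros assms)

lemma polys_prod:
  assumes "1 \<in> K" "\<And>s. s \<in> S \<Longrightarrow> f s \<in> polys K I"
  shows "(\<lambda>x. \<Prod>s\<in>S. f s x) \<in> polys K I"
  using assms(2)
proof (induction S rule: infinite_finite_induct)
  case (insert s S)
  then show ?case by (simp add: polys_mult)
qed (use assms(1) in \<open>auto intro: polys_const\<close>)

lemma polys_uminus: "-1 \<in> K \<Longrightarrow> f \<in> polys K I \<Longrightarrow> (\<lambda>x. - f x) \<in> polys K I"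
  using polys_mult[OF polys_const[of "-1" K I], of f] by simp

lemma polys_diff: "-1 \<in> K \<Longrightarrow> f \<in> polys K I \<Longrightarrow> g \<in> polys K I \<Longrightarrow> (\<lambda>x. f x - g x) \<in> polys K I"
  using polys_add[OF _ polys_uminus, of f K I g] by simp

lemma polys_compose:
  assumes "g \<in> polys K A" "\<And>a. a \<in> A \<Longrightarrow> f a \<in> polys K I"
  shows "(\<lambda>x. g (\<lambda>a. f a x)) \<in> polys K I"
  using assms by (induction rule: polys.induct) (auto intro: polys.intros)

lemma countable_polys:
  assumes "countable K" "countable I"
  shows "countable (polys K I)"
proof -
  define step where "step = (\<lambda>A :: (('a \<Rightarrow> real) \<Rightarrow> real) set.
    A \<union> (\<lambda>(f, g) x. f x + g x) ` (A \<times> A) \<union> (\<lambda>(f, g) x. f x * g x) ` (A \<times> A))"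
  define L where "L = (\<lambda>n. (step ^^ n) ((\<lambda>c x. c) ` K \<union> (\<lambda>i x. x i) ` I))"
  have L0: "L 0 = (\<lambda>c x. c) ` K \<union> (\<lambda>i x. x i) ` I" and LS: "L (Suc n) = step (L n)" for n
    by (auto simp: L_def)
  have mono: "L m \<subseteq> L n" if "m \<le> n" for m n
    using that by (induction n rule: dec_induct) (auto simp: LS step_def)
  have "countable (L n)" for n
    by (induction n) (use assms in \<open>auto simp: L0 LS step_def\<close>)
  moreover have "polys K I \<subseteq> (\<Union>n. L n)"
  proof
    fix f assume "f \<in> polys K I"
    then show "f \<in> (\<Union>n. L n)"
    proof (induction rule: polys.induct)
      case (polys_const c)
      then show ?case using L0 by blast
    next
      case (polys_var i)
      then show ?case using L0 by blast
    next
      case (polys_add f g)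
      then obtain m n where "f \<in> L m" "g \<in> L n" by auto
      with mono[of m "max m n"] mono[of n "max m n"]
      have "f \<in> L (max m n)" "g \<in> L (max m n)" by auto
      then have "(\<lambda>x. f x + g x) \<in> L (Suc (max m n))" unfolding LS step_def by force
      then show ?case by blast
    next
      case (polys_mult f g)
      then obtain m n where "f \<in> L m" "g \<in> L n" by auto
      with mono[of m "max m n"] mono[of n "max m n"]
      have "f \<in> L (max m n)" "g \<in> L (max m n)" by auto
      then have "(\<lambda>x. f x * g x) \<in> L (Suc (max m n))" unfolding LS step_def by force
      then show ?case by blast
    qed
  qed
  ultimately show ?thesis by (meson countable_UN countable_subset countableI_type)
qed

text \<open>Singles out one variable so that root counting for univariate polynomials applies. If
  \<open>i \<notin> I\<close>, the coefficients do not depend on \<open>z i\<close>. The functions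
  with such an expansion are closed under sums and products.\<close>

lemma polys_insert_expand:
  assumes "0 \<in> K" "1 \<in> K" "f \<in> polys K (insert i I)"
  obtains n c where "\<And>k. c k \<in> polys K I" "\<And>z. f z = (\<Sum>k<n. c k z * z i ^ k)"
proof -
  define E where "E = {f. \<exists>n c. (\<forall>k. c k \<in> polys K I) \<and> (\<forall>z. f z = (\<Sum>k<n::nat. c k z * z i ^ k))}"
  have E_add: "(\<lambda>z. f z + g z) \<in> E" if fg: "f \<in> E" "g \<in> E" for f g
  proof -
    from fg obtain n c m b where c: "\<And>k. c k \<in> polys K I" "\<And>z. f z = (\<Sum>k<n::nat. c k z * z i ^ k)"
      and b: "\<And>k. b k \<in> polys K I" "\<And>z. g z = (\<Sum>k<m::nat. b k z * z i ^ k)"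
      unfolding E_def by auto
    define c' where "c' = (\<lambda>k. if k < n then c k else (\<lambda>z. 0))"
    define b' where "b' = (\<lambda>k. if k < m then b k else (\<lambda>z. 0))"
    have "f z = (\<Sum>k<max n m. c' k z * z i ^ k)" for z
      unfolding c(2) by (rule sum.mono_neutral_cong_left) (auto simp: c'_def)
    moreover have "g z = (\<Sum>k<max n m. b' k z * z i ^ k)" for z
      unfolding b(2) by (rule sum.mono_neutral_cong_left) (auto simp: b'_def)
    ultimately have "f z + g z = (\<Sum>k<max n m. (c' k z + b' k z) * z i ^ k)" for z
      by (simp add: sum.distrib ring_distribs)
    moreover have "(\<lambda>z. c' k z + b' k z) \<in> polys K I" for k
      using c b assms(1) unfolding c'_def b'_def by (auto intro: polys.intros)
    ultimately show ?thesis unfolding E_def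
      by (intro CollectI exI[of _ "max n m"] exI[of _ "\<lambda>k z. c' k z + b' k z"]) auto
  qed
  have E_mono: "(\<lambda>z. g z * z i ^ k) \<in> E" if "g \<in> polys K I" for g k
  proof -
    have "g z * z i ^ k = (\<Sum>l<Suc k. (if l = k then g z else 0) * z i ^ l)" for z by simp
    moreover have "(\<lambda>z. if l = k then g z else 0) \<in> polys K I" for l
      using that polys_const[OF assms(1)] by (cases "l = k") auto
    ultimately show ?thesis unfolding E_def
      by (intro CollectI exI[of _ "Suc k"] exI[of _ "\<lambda>l z. if l = k then g z else 0"]) blast
  qed
  have E_0: "(\<lambda>z. 0) \<in> E"
    unfolding E_def using polys_const[OF assms(1)] by (intro CollectI exI[of _ 0] exI[of _ "\<lambda>k z. 0"]) simp
  have E_sum: "(\<lambda>z. \<Sum>s\<in>S. h s z) \<in> E" if "finite S" "\<And>s. s \<in> S \<Longrightarrow> h s \<in> E" for S :: "(nat \<times> nat) set" and h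
    using that by (induction S) (auto intro: E_add E_0)
  have "f \<in> E" using assms(3)
  proof (induction rule: polys.induct)
    case (polys_const c)
    then show ?case using E_mono[of "\<lambda>x. c" 0] by (auto intro: polys.intros)
  next
    case (polys_var j)
    then consider "j = i" | "j \<in> I" by auto
    then show ?case
      using E_mono[of "\<lambda>x. x j" 0] E_mono[of "\<lambda>x. 1" 1] assms by cases (auto intro: polys.intros)
  next
    case (polys_add f g)
    then show ?case using E_add by auto
  next
    case (polys_mult f g)
    then obtain n c m b where c: "\<And>k. c k \<in> polys K I" "\<And>z. f z = (\<Sum>k<n::nat. c k z * z i ^ k)"
      and b: "\<And>k. b k \<in> polys K I" "\<And>z. g z = (\<Sum>k<m::nat. b k z * z i ^ k)"
      unfolding E_def by auto
    have "f z * g z = (\<Sum>(k,l)\<in>{..<n}\<times>{..<m}. (c k z * b l z) * z i ^ (k + l))" for z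
      unfolding c b sum_product sum.cartesian_product
      by (intro sum.cong) (auto simp: power_add)
    moreover have "(\<lambda>z. \<Sum>s\<in>{..<n}\<times>{..<m}. (case s of (k,l) \<Rightarrow> (c k z * b l z) * z i ^ (k + l))) \<in> E"
      by (rule E_sum) (auto intro!: E_mono polys.intros c b)
    ultimately show ?case by simp
  qed
  then show ?thesis using that unfolding E_def by auto
qed

text \<open>Each equation eliminates at most one unknown. The field is arbitrary because there are
  two uses: over the rationals for the coefficients of an algebraic relation, and over the reals for
  a direction orthogonal to given gradients.\<close>

lemma homogeneous_system_nontrivial:
  fixes a :: "'s \<Rightarrow> 'j \<Rightarrow> 'a :: field"
  assumes "finite S" "finite J" "card S < card J"
  shows "\<exists>m. (\<exists>j\<in>J. m j \<noteq> 0) \<and> (\<forall>s\<in>S. (\<Sum>j\<in>J. a s j * m j) = 0)"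
  using assms
proof (induction S arbitrary: J a rule: finite_induct)
  case empty
  then obtain j where "j \<in> J" by (metis all_not_in_conv card.empty less_nat_zero_code)
  then show ?case by (intro exI[of _ "\<lambda>_. 1"]) auto
next
  case (insert s S)
  show ?case
  proof (cases "\<forall>j\<in>J. a s j = 0")
    case True
    have "card S < card J" using insert by simp
    from insert.IH[OF insert.prems(1) this, of a] obtain m where "\<exists>j\<in>J. m j \<noteq> 0" "\<forall>s\<in>S. (\<Sum>j\<in>J. a s j * m j) = 0" by blast
    with True show ?thesis by (intro exI[of _ m]) auto
  next
    case False
    then obtain j0 where j0: "j0 \<in> J" "a s j0 \<noteq> 0" by auto
    define J' where "J' = J - {j0}"
    have J: "J = insert j0 J'" "j0 \<notin> J'" "finite J'" using j0 insert by (auto simp: J'_def)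
    then have "card S < card J'" using insert by simp
    from insert.IH[OF J(3) this, of "\<lambda>t k. a t k - a t j0 * a s k / a s j0"]
    obtain m where m: "\<exists>j\<in>J'. m j \<noteq> 0"
      "\<And>t. t \<in> S \<Longrightarrow> (\<Sum>k\<in>J'. (a t k - a t j0 * a s k / a s j0) * m k) = 0" by auto
    define w where "w = - (\<Sum>k\<in>J'. a s k * m k) / a s j0"
    define m' where "m' = m(j0 := w)"
    have sum: "(\<Sum>k\<in>J. a t k * m' k) = a t j0 * w + (\<Sum>k\<in>J'. a t k * m k)" for t
    proof -
      have "(\<Sum>k\<in>J'. a t k * m' k) = (\<Sum>k\<in>J'. a t k * m k)"
        by (rule sum.cong) (use J in \<open>auto simp: m'_def\<close>)
      then show ?thesis using J by (simp add: m'_def)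
    qed
    have "(\<Sum>k\<in>J. a t k * m' k) = 0" if "t \<in> insert s S" for t
    proof (cases "t = s")
      case True
      then show ?thesis using j0 by (simp add: sum w_def)
    next
      case False
      then have "t \<in> S" using that by simp
      have eq: "(\<Sum>k\<in>J'. (a t k - a t j0 * a s k / a s j0) * m k)
          = a t j0 * w + (\<Sum>k\<in>J'. a t k * m k)"
        by (simp add: w_def left_diff_distrib sum_subtractf sum_distrib_left sum_divide_distrib mult.assoc)
      show ?thesis unfolding sum using trans[OF sym[OF eq] m(2)[OF \<open>t \<in> S\<close>]] .
    qed
    moreover have "\<exists>j\<in>J. m' j \<noteq> 0" using m(1) J by (auto simp: m'_def)
    ultimately show ?thesis by blast
  qed
qed

text \<open>Grouping by the exponent of one variable gives a univariate polynomial that vanishes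
  everywhere; its coefficients vanish, and each is a sum of the same kind in fewer variables.
  Exponents are attached to abstract labels \<open>m\<close>, so that extensional functions and
  formal monomials are both covered.\<close>

lemma monomials_independent:
  fixes c :: "'m \<Rightarrow> real" and e :: "'m \<Rightarrow> 'i \<Rightarrow> nat"
  assumes "finite I" "finite M"
    and "\<And>m m'. m \<in> M \<Longrightarrow> m' \<in> M \<Longrightarrow> (\<And>i. i \<in> I \<Longrightarrow> e m i = e m' i) \<Longrightarrow> m = m'"
    and "\<And>x. (\<Sum>m\<in>M. c m * (\<Prod>i\<in>I. x i ^ e m i)) = 0"
  shows "\<forall>m\<in>M. c m = 0"
  using assms
proof (induction I arbitrary: M rule: finite_induct)
  case empty
  then show ?case
  proof (intro ballI)
    fix m assume "m \<in> M"
    then have "M = {m}" using empty.prems(2) by auto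
    then show "c m = 0" using empty.prems(3)[of undefined] by simp
  qed
next
  case (insert i I)
  obtain n where n: "\<And>m. m \<in> M \<Longrightarrow> e m i \<le> n"
    using finite_nat_set_iff_bounded_le[of "(\<lambda>m. e m i) ` M"] insert.prems(1) by auto
  have zero: "(\<Sum>m\<in>{m\<in>M. e m i = k}. c m * (\<Prod>j\<in>I. x j ^ e m j)) = 0" if "k \<le> n" for k x
  proof -
    have "(\<Sum>k\<le>n. (\<Sum>m\<in>{m\<in>M. e m i = k}. c m * (\<Prod>j\<in>I. x j ^ e m j)) * t ^ k) = 0" for t
    proof -
      have "0 = (\<Sum>m\<in>M. c m * (\<Prod>j\<in>insert i I. (x(i := t)) j ^ e m j))"
        using insert.prems(3) by simp
      also have "\<dots> = (\<Sum>m\<in>M. c m * (\<Prod>j\<in>I. x j ^ e m j) * t ^ e m i)"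
      proof (rule sum.cong)
        fix m
        have "(\<Prod>j\<in>I. (x(i := t)) j ^ e m j) = (\<Prod>j\<in>I. x j ^ e m j)"
          by (rule prod.cong) (use insert in auto)
        then show "c m * (\<Prod>j\<in>insert i I. (x(i := t)) j ^ e m j) = c m * (\<Prod>j\<in>I. x j ^ e m j) * t ^ e m i"
          using insert by simp
      qed simp
      also have "\<dots> = (\<Sum>k\<le>n. \<Sum>m\<in>{m\<in>M. e m i = k}. c m * (\<Prod>j\<in>I. x j ^ e m j) * t ^ e m i)"
        by (rule sum.group[symmetric]) (use insert.prems(1) n in auto)
      also have "\<dots> = (\<Sum>k\<le>n. (\<Sum>m\<in>{m\<in>M. e m i = k}. c m * (\<Prod>j\<in>I. x j ^ e m j)) * t ^ k)"
        by (simp add: sum_distrib_right)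
      finally show ?thesis by simp
    qed
    then have "\<forall>k\<le>n. (\<Sum>m\<in>{m\<in>M. e m i = k}. c m * (\<Prod>j\<in>I. x j ^ e m j)) = 0"
      using polyfun_eq_0[of "\<lambda>k. \<Sum>m\<in>{m\<in>M. e m i = k}. c m * (\<Prod>j\<in>I. x j ^ e m j)" n] by blast
    then show ?thesis using that by blast
  qed
  show ?case
  proof
    fix m assume m: "m \<in> M"
    have "m' = m''" if "m' \<in> {m'\<in>M. e m' i = e m i}" "m'' \<in> {m'\<in>M. e m' i = e m i}"
      "\<And>i. i \<in> I \<Longrightarrow> e m' i = e m'' i" for m' m''
      by (rule insert.prems(2)) (use that in auto)
    then have "\<forall>m'\<in>{m'\<in>M. e m' i = e m i}. c m' = 0"
      by (intro insert.IH) (use insert.prems(1) zero[OF n[OF m]] in auto)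
    then show "c m = 0" using m by simp
  qed
qed

section \<open>Algebraic dependence by a dimension count\<close>

definition box :: "'i set \<Rightarrow> nat \<Rightarrow> ('i \<Rightarrow> nat) set" where
  "box I k = PiE I (\<lambda>_. {..k})"

definition mon :: "'i set \<Rightarrow> ('i \<Rightarrow> nat) \<Rightarrow> ('i \<Rightarrow> real) \<Rightarrow> real" where
  "mon I b x = (\<Prod>i\<in>I. x i ^ b i)"

text \<open>The rational polynomial functions of degree at most \<open>k\<close> in each variable
  separately. Bounding each exponent instead of the total degree makes the number of monomials the
  plain power \<open>(k + 1) ^ card I\<close>.\<close>

definition boxspan :: "'i set \<Rightarrow> nat \<Rightarrow> (('i \<Rightarrow> real) \<Rightarrow> real) set" where
  "boxspan I k = {h. \<exists>a::_ \<Rightarrow> rat. \<forall>x. h x = (\<Sum>b\<in>box I k. of_rat (a b) * mon I b x)}"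

context
  fixes I :: "'i set"
  assumes fin: "finite I"
begin

lemma finite_box: "finite (box I k)"
  unfolding box_def using fin by (intro finite_PiE) auto

lemma card_box: "card (box I k) = (k + 1) ^ card I"
  unfolding box_def using fin by (simp add: card_PiE)

lemma boxspan_add: "f \<in> boxspan I k \<Longrightarrow> g \<in> boxspan I k \<Longrightarrow> (\<lambda>x. f x + g x) \<in> boxspan I k"
proof -
  assume "f \<in> boxspan I k" "g \<in> boxspan I k"
  then obtain a b :: "_ \<Rightarrow> rat" where "\<forall>x. f x = (\<Sum>m\<in>box I k. of_rat (a m) * mon I m x)"
    "\<forall>x. g x = (\<Sum>m\<in>box I k. of_rat (b m) * mon I m x)" unfolding boxspan_def by auto
  then show ?thesis unfolding boxspan_def
    by (intro CollectI exI[of _ "\<lambda>m. a m + b m"]) (simp add: of_rat_add sum.distrib ring_distribs)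
qed

lemma boxspan_0: "(\<lambda>x. 0) \<in> boxspan I k"
  unfolding boxspan_def by (intro CollectI exI[of _ "\<lambda>m. 0"]) simp

lemma boxspan_sum: "(\<And>s. s \<in> S \<Longrightarrow> f s \<in> boxspan I k) \<Longrightarrow> (\<lambda>x. \<Sum>s\<in>S. f s x) \<in> boxspan I k"
  by (induction S rule: infinite_finite_induct) (auto intro: boxspan_add boxspan_0)

lemma boxspan_mon:
  assumes "\<And>i. i \<in> I \<Longrightarrow> b i \<le> k"
  shows "(\<lambda>x. of_rat r * mon I b x) \<in> boxspan I k"
proof -
  have "restrict b I \<in> box I k" using assms by (auto simp: box_def)
  moreover have "mon I b x = mon I (restrict b I) x" for x unfolding mon_def by simp
  ultimately have "of_rat r * mon I b x
      = (\<Sum>m\<in>box I k. of_rat (if m = restrict b I then r else 0) * mon I m x)" for x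
    using finite_box by (simp add: if_distrib if_distribR sum.delta cong: if_cong)
  then show ?thesis unfolding boxspan_def
    by (intro CollectI exI[of _ "\<lambda>m. if m = restrict b I then r else 0"]) blast
qed

lemma boxspan_mult:
  assumes "f \<in> boxspan I k" "g \<in> boxspan I l"
  shows "(\<lambda>x. f x * g x) \<in> boxspan I (k + l)"
proof -
  from assms obtain a b :: "_ \<Rightarrow> rat" where ab: "\<And>x. f x = (\<Sum>m\<in>box I k. of_rat (a m) * mon I m x)"
    "\<And>x. g x = (\<Sum>m\<in>box I l. of_rat (b m) * mon I m x)" unfolding boxspan_def by auto
  have "f x * g x = (\<Sum>s\<in>box I k \<times> box I l. of_rat (a (fst s) * b (snd s)) * mon I (\<lambda>i. fst s i + snd s i) x)" for x
    unfolding ab sum_product sum.cartesian_product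
    by (intro sum.cong) (auto simp: mon_def power_add prod.distrib of_rat_mult)
  moreover have "(\<lambda>x. \<Sum>s\<in>box I k \<times> box I l. of_rat (a (fst s) * b (snd s)) * mon I (\<lambda>i. fst s i + snd s i) x) \<in> boxspan I (k + l)"
    by (intro boxspan_sum boxspan_mon) (auto simp: box_def PiE_iff intro!: add_mono)
  ultimately show ?thesis by simp
qed

lemma boxspan_mono:
  assumes "k \<le> l"
  shows "boxspan I k \<subseteq> boxspan I l"
proof
  fix f assume "f \<in> boxspan I k"
  then obtain a :: "_ \<Rightarrow> rat" where a: "\<And>x. f x = (\<Sum>m\<in>box I k. of_rat (a m) * mon I m x)"
    unfolding boxspan_def by auto
  have "(\<lambda>x. \<Sum>m\<in>box I k. of_rat (a m) * mon I m x) \<in> boxspan I l"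
    by (intro boxspan_sum boxspan_mon) (use assms in \<open>auto simp: box_def PiE_iff intro: le_trans\<close>)
  then show "f \<in> boxspan I l" using a by (metis (no_types, lifting) ext)
qed

lemma boxspan_const: "(\<lambda>x. of_rat r) \<in> boxspan I k"
  using boxspan_mon[of "\<lambda>_. 0" k r] by (simp add: mon_def)

lemma polys_boxspan: "f \<in> polys \<rat> I \<Longrightarrow> \<exists>k. f \<in> boxspan I k"
proof (induction rule: polys.induct)
  case (polys_const c)
  then show ?case using boxspan_const by (auto elim!: Rats_cases)
next
  case (polys_var i)
  have "mon I (\<lambda>j. if j = i then 1 else 0) x = x i" for x
    unfolding mon_def using polys_var fin by (simp add: if_distrib prod.delta cong: if_cong)
  then have "(\<lambda>x. x i) \<in> boxspan I 1"
    using boxspan_mon[of "\<lambda>j. if j = i then 1 else 0" 1 1] by (simp cong: if_cong)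
  then show ?case by blast
next
  case (polys_add f g)
  then obtain k l where "f \<in> boxspan I k" "g \<in> boxspan I l" by auto
  then show ?case using boxspan_mono[of k "max k l"] boxspan_mono[of l "max k l"]
    by (intro exI[of _ "max k l"] boxspan_add) auto
next
  case (polys_mult f g)
  then show ?case using boxspan_mult by blast
qed

lemma boxspan_power: "f \<in> boxspan I k \<Longrightarrow> (\<lambda>x. f x ^ n) \<in> boxspan I (n * k)"
proof (induction n)
  case 0
  then show ?case using boxspan_const[of 1] by simp
next
  case (Suc n)
  then show ?case using boxspan_mult[of f k "\<lambda>x. f x ^ n" "n * k"] by simp
qed

lemma boxspan_prod:
  "finite A \<Longrightarrow> (\<And>a. a \<in> A \<Longrightarrow> f a \<in> boxspan I k) \<Longrightarrow> (\<lambda>x. \<Prod>a\<in>A. f a x) \<in> boxspan I (card A * k)"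
proof (induction A rule: finite_induct)
  case empty
  then show ?case using boxspan_const[of 1] by simp
next
  case (insert a A)
  then show ?case using boxspan_mult[of "f a" k "\<lambda>x. \<Prod>a\<in>A. f a x" "card A * k"] by simp
qed

end

text \<open>The products of powers at most \<open>N\<close> of the given polynomials number \<open>(N + 1) ^ card A\<close>, but
  they lie in a space of dimension \<open>O(N ^ card I)\<close>.\<close>

lemma polys_algebraically_dependent:
  fixes A :: "(('i \<Rightarrow> real) \<Rightarrow> real) set"
  assumes "finite I" "finite A" "A \<subseteq> polys \<rat> I" "card I < card A"
  obtains g where "g \<in> polys \<rat> A" "\<exists>z. g z \<noteq> 0" "\<And>x. g (\<lambda>a. a x) = 0"
proof -
  obtain k where k: "\<And>f. f \<in> A \<Longrightarrow> f \<in> boxspan I k"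
  proof -
    have "\<forall>f\<in>A. \<exists>k. f \<in> boxspan I k" using polys_boxspan[OF assms(1)] assms(3) by auto
    then obtain kf where kf: "\<And>f. f \<in> A \<Longrightarrow> f \<in> boxspan I (kf f)" by metis
    obtain k where "\<And>f. f \<in> A \<Longrightarrow> kf f \<le> k"
      using finite_nat_set_iff_bounded_le[of "kf ` A"] assms(2) by auto
    then show ?thesis using that kf boxspan_mono[OF assms(1)] by blast
  qed
  \<comment> \<open>A product of powers up to \<open>N\<close> has degree at most \<open>L\<close>
    in each variable. Since \<open>L + 1 \<le> C * (N + 1)\<close>, it suffices that
    \<open>C ^ card I < N + 1\<close>, which dictates \<open>N\<close>.\<close>
  define C where "C = card A * k + 1"
  define N where "N = C ^ card I"
  define L where "L = card A * (N * k)"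
  have "L + 1 \<le> C * (N + 1)" by (simp add: L_def C_def algebra_simps)
  then have "(L + 1) ^ card I \<le> C ^ card I * (N + 1) ^ card I"
    by (metis power_mono power_mult_distrib zero_le)
  also have "\<dots> < (N + 1) * (N + 1) ^ card I" by (simp add: N_def)
  also have "\<dots> \<le> (N + 1) ^ card A"
    using power_increasing[of "Suc (card I)" "card A" "N + 1"] assms(4) by simp
  finally have cards: "card (box I L) < card (box A N)"
    using card_box assms(1,2) by metis
  have "(\<lambda>x. mon A al (\<lambda>a. a x)) \<in> boxspan I L" if "al \<in> box A N" for al
  proof -
    have "(\<lambda>x. \<Prod>a\<in>A. a x ^ al a) \<in> boxspan I (card A * (N * k))"
    proof (rule boxspan_prod[OF assms(1,2)])
      fix a assume "a \<in> A"
      then have "(\<lambda>x. a x ^ al a) \<in> boxspan I (al a * k)" "al a * k \<le> N * k"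
        using boxspan_power[OF assms(1) k] that by (auto simp: box_def)
      then show "(\<lambda>x. a x ^ al a) \<in> boxspan I (N * k)" using boxspan_mono[OF assms(1)] by blast
    qed
    then show ?thesis by (simp add: mon_def L_def)
  qed
  then have "\<forall>al\<in>box A N. \<exists>r::_ \<Rightarrow> rat. \<forall>x. mon A al (\<lambda>a. a x) = (\<Sum>b\<in>box I L. of_rat (r b) * mon I b x)"
    unfolding boxspan_def by auto
  from bchoice[OF this] obtain r :: "_ \<Rightarrow> _ \<Rightarrow> rat" where r: "\<And>al x. al \<in> box A N \<Longrightarrow>
      mon A al (\<lambda>a. a x) = (\<Sum>b\<in>box I L. of_rat (r al b) * mon I b x)" by blast
  obtain c :: "_ \<Rightarrow> rat" where c: "\<exists>al\<in>box A N. c al \<noteq> 0"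
      "\<And>b. b \<in> box I L \<Longrightarrow> (\<Sum>al\<in>box A N. r al b * c al) = 0"
    using homogeneous_system_nontrivial[OF finite_box[OF assms(1)] finite_box[OF assms(2)] cards, of "\<lambda>b al. r al b"] by blast
  define g where "g = (\<lambda>z. \<Sum>al\<in>box A N. of_rat (c al) * mon A al z)"
  have "g \<in> polys \<rat> A" unfolding g_def mon_def
    by (intro polys_sum polys_mult polys_prod polys_power polys_var polys_const) auto
  moreover have "\<exists>z. g z \<noteq> 0"
  proof (rule ccontr)
    assume "\<nexists>z. g z \<noteq> 0"
    then have "(\<Sum>al\<in>box A N. of_rat (c al) * (\<Prod>i\<in>A. x i ^ al i)) = (0::real)" for x
      by (simp add: g_def mon_def)
    moreover have "m = m'" if "m \<in> box A N" "m' \<in> box A N" "\<And>i. i \<in> A \<Longrightarrow> m i = m' i" for m m'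
      using that unfolding box_def by (rule PiE_ext)
    ultimately have "\<forall>m\<in>box A N. of_rat (c m) = (0::real)"
      by (rule monomials_independent[where e = "\<lambda>m. m", OF assms(2) finite_box[OF assms(2)], rotated])
    with c(1) show False by simp
  qed
  moreover have "g (\<lambda>a. a x) = 0" for x
  proof -
    have "g (\<lambda>a. a x) = (\<Sum>al\<in>box A N. \<Sum>b\<in>box I L. of_rat (c al) * (of_rat (r al b) * mon I b x))"
      by (simp add: g_def r sum_distrib_left)
    also have "\<dots> = (\<Sum>b\<in>box I L. \<Sum>al\<in>box A N. of_rat (c al) * (of_rat (r al b) * mon I b x))"
      by (rule sum.swap)
    also have "\<dots> = (\<Sum>b\<in>box I L. of_rat (\<Sum>al\<in>box A N. r al b * c al) * mon I b x)"
      by (simp add: of_rat_sum of_rat_mult sum_distrib_right sum_distrib_left mult_ac)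
    also have "\<dots> = 0" using c(2) by simp
    finally show ?thesis .
  qed
  ultimately show ?thesis using that by blast
qed

section \<open>Derivatives and the choice of generic points\<close>

lemma polys_directional_derivative:
  assumes "finite I" "f \<in> polys \<rat> I"
  shows "\<exists>a. (\<forall>i\<in>I. a i \<in> polys \<rat> I) \<and>
    (\<forall>x m. ((\<lambda>t. f (\<lambda>i. x i + t * m i)) has_real_derivative (\<Sum>i\<in>I. a i x * m i)) (at 0))"
  using assms(2)
proof (induction rule: polys.induct)
  case (polys_const c)
  then show ?case by (intro exI[of _ "\<lambda>i x. 0"]) (auto intro: polys.intros)
next
  case (polys_var j)
  have "(\<Sum>i\<in>I. (if i = j then 1 else 0) * m i) = m j" for m :: "_ \<Rightarrow> real"
    using polys_var assms(1) by (simp add: mult_delta_left)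
  moreover have "((\<lambda>t. x j + t * m j) has_real_derivative m j) (at 0)" for x m :: "_ \<Rightarrow> real"
    by (auto intro!: derivative_eq_intros)
  ultimately show ?case
    by (intro exI[of _ "\<lambda>i x. if i = j then 1 else 0"]) (auto intro: polys.intros)
next
  case (polys_add f g)
  then obtain a b where a: "\<forall>i\<in>I. a i \<in> polys \<rat> I"
      "\<And>x m. ((\<lambda>t. f (\<lambda>i. x i + t * m i)) has_real_derivative (\<Sum>i\<in>I. a i x * m i)) (at 0)"
    and b: "\<forall>i\<in>I. b i \<in> polys \<rat> I"
      "\<And>x m. ((\<lambda>t. g (\<lambda>i. x i + t * m i)) has_real_derivative (\<Sum>i\<in>I. b i x * m i)) (at 0)"
    by blast
  show ?case
    using a(1) b(1) DERIV_add[OF a(2) b(2)]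
    by (intro exI[of _ "\<lambda>i x. a i x + b i x"])
      (auto simp: sum.distrib ring_distribs intro!: polys.polys_add)
next
  case (polys_mult f g)
  then obtain a b where a: "\<forall>i\<in>I. a i \<in> polys \<rat> I"
      "\<And>x m. ((\<lambda>t. f (\<lambda>i. x i + t * m i)) has_real_derivative (\<Sum>i\<in>I. a i x * m i)) (at 0)"
    and b: "\<forall>i\<in>I. b i \<in> polys \<rat> I"
      "\<And>x m. ((\<lambda>t. g (\<lambda>i. x i + t * m i)) has_real_derivative (\<Sum>i\<in>I. b i x * m i)) (at 0)"
    by blast
  have "((\<lambda>t. f (\<lambda>i. x i + t * m i) * g (\<lambda>i. x i + t * m i))
      has_real_derivative (\<Sum>i\<in>I. (a i x * g x + b i x * f x) * m i)) (at 0)" for x m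
    using DERIV_mult[OF a(2)[of x m] b(2)[of x m]]
    by (simp add: sum.distrib ring_distribs sum_distrib_left mult_ac)
  moreover have "\<forall>i\<in>I. (\<lambda>x. a i x * g x + b i x * f x) \<in> polys \<rat> I"
    using a(1) b(1) polys_mult.hyps by (auto intro!: polys.intros)
  ultimately show ?case by (intro exI[of _ "\<lambda>i x. a i x * g x + b i x * f x"]) blast
qed

lemma polys_derivative_zero:
  assumes "g \<in> polys K S" "\<And>s. s \<in> S \<Longrightarrow> ((\<lambda>t. y t s) has_real_derivative 0) (at t0)"
  shows "((\<lambda>t. g (y t)) has_real_derivative 0) (at t0)"
  using assms
proof (induction rule: polys.induct)
  case (polys_add f g)
  then show ?case using DERIV_add by fastforce
next
  case (polys_mult f g)
  then show ?case using DERIV_mult by fastforce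
qed auto

lemma generic_pointD: "generic_point K I x \<Longrightarrow> g \<in> polys K I \<Longrightarrow> g x = 0 \<Longrightarrow> g z = 0"
  unfolding generic_point_def by blast

lemma generic_point_empty: "generic_point K {} x"
  unfolding generic_point_def using polys_cong by (metis empty_iff)

text \<open>A nonzero polynomial has a nonzero coefficient with respect to the new variable, and
  this stays nonzero at the generic point \<open>x\<close>, so only finitely many values of the new
  coordinate are roots. There are only countably many polynomials.\<close>

lemma generic_point_extend:
  assumes "countable K" "countable I" "0 \<in> K" "1 \<in> K" "generic_point K I x" "i \<notin> I"
  shows "countable {t. \<not> generic_point K (insert i I) (x(i := t))}"
proof -
  define Z where "Z = (\<lambda>g :: ('a \<Rightarrow> real) \<Rightarrow> real. {t. g (x(i := t)) = 0})"
  have "finite (Z g)" if g: "g \<in> polys K (insert i I)" "g z0 \<noteq> 0" for g z0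
  proof -
    obtain n c where c: "\<And>k. c k \<in> polys K I" "\<And>z. g z = (\<Sum>k<n. c k z * z i ^ k)"
      by (rule polys_insert_expand[OF assms(3,4) g(1)]) (rule that)
    define U where "U = (\<Sum>k<n. monom (c k x) k)"
    have "U \<noteq> 0"
    proof
      assume "U = 0"
      have "c k x = 0" if "k < n" for k
        using arg_cong[OF \<open>U = 0\<close>, of "\<lambda>p. coeff p k"] that unfolding U_def
        by (simp add: coeff_sum)
      then have "c k z0 = 0" if "k < n" for k
        using that generic_pointD[OF assms(5) c(1)] by simp
      then show False using g(2) c(2) by simp
    qed
    moreover have "Z g \<subseteq> {t. poly U t = 0}"
    proof
      fix t assume "t \<in> Z g"
      moreover have "c k (x(i := t)) = c k x" for k
        by (rule polys_cong[OF c(1)]) (use assms(6) in auto)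
      ultimately show "t \<in> {t. poly U t = 0}"
        unfolding Z_def U_def by (simp add: c(2) poly_sum poly_monom)
    qed
    ultimately show ?thesis using poly_roots_finite finite_subset by blast
  qed
  then have "countable (\<Union>g \<in> {g \<in> polys K (insert i I). \<exists>z. g z \<noteq> 0}. Z g)"
    using countable_polys[OF assms(1), of "insert i I"] assms(2)
    by (intro countable_UN) (auto intro: countable_finite countable_subset[of _ "polys K (insert i I)"])
  moreover have "{t. \<not> generic_point K (insert i I) (x(i := t))} \<subseteq>
      (\<Union>g \<in> {g \<in> polys K (insert i I). \<exists>z. g z \<noteq> 0}. Z g)"
    unfolding generic_point_def Z_def by auto
  ultimately show ?thesis by (rule countable_subset[rotated])
qed

text \<open>Countably many bad values are excluded at each new coordinate, so two conditions can be
  met at once: genericity over \<open>K\<close> together with the old coordinates, and genericity of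
  the new ones over another countable set \<open>L\<close>, which may contain coordinates of other
  points.\<close>

lemma generic_point_extend_finite:
  assumes "countable K" "countable L" "countable I" "finite J" "I \<inter> J = {}"
    "0 \<in> K" "1 \<in> K" "0 \<in> L" "1 \<in> L" "generic_point K I x"
  obtains y where "\<And>i. i \<in> I \<Longrightarrow> y i = x i" "generic_point K (I \<union> J) y" "generic_point L J y"
proof -
  have "\<exists>y. (\<forall>i\<in>I. y i = x i) \<and> generic_point K (I \<union> J) y \<and> generic_point L J y"
    using assms(4,5)
  proof (induction J rule: finite_induct)
    case empty
    then show ?case using assms(10) generic_point_empty by auto
  next
    case (insert j J)
    then obtain y where y: "\<forall>i\<in>I. y i = x i" "generic_point K (I \<union> J) y" "generic_point L J y"
      by auto
    have "countable ({t. \<not> generic_point K (insert j (I \<union> J)) (y(j := t))} \<union>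
        {t. \<not> generic_point L (insert j J) (y(j := t))})"
      using y insert assms
      by (intro countable_Un generic_point_extend) (auto intro: countable_finite)
    then obtain t where "generic_point K (insert j (I \<union> J)) (y(j := t))"
        "generic_point L (insert j J) (y(j := t))"
      using uncountable_UNIV_real
      by (metis (mono_tags, lifting) UNIV_eq_I UnI1 UnI2 mem_Collect_eq)
    moreover have "(y(j := t)) i = x i" if "i \<in> I" for i using y(1) insert.prems that by auto
    ultimately have "(\<forall>i\<in>I. (y(j := t)) i = x i) \<and>
        generic_point K (I \<union> insert j J) (y(j := t)) \<and> generic_point L (insert j J) (y(j := t))"
      unfolding Un_insert_right by blast
    then show ?case by (rule exI[of _ "y(j := t)"])
  qed
  then show ?thesis using that by blast
qed

text \<open>Gaussian elimination without divisions keeps the entries polynomial, so that a pivot which is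
  nonzero at one point is nonzero at every generic point.\<close>

lemma injective_at_generic_point:
  assumes "finite J" "-1 \<in> K" "\<And>s j. s \<in> S \<Longrightarrow> j \<in> J \<Longrightarrow> a s j \<in> polys K I"
    and "generic_point K I x"
    and "\<And>m. (\<And>s. s \<in> S \<Longrightarrow> (\<Sum>j\<in>J. a s j x0 * m j) = 0) \<Longrightarrow> \<forall>j\<in>J. m j = 0"
    and "\<And>s. s \<in> S \<Longrightarrow> (\<Sum>j\<in>J. a s j x * m j) = 0"
  shows "\<forall>j\<in>J. m j = 0"
  using assms(1,3,5,6)
proof (induction J arbitrary: a rule: finite_induct)
  case empty
  then show ?case by simp
next
  case (insert j J)
  \<comment> \<open>If column \<open>j\<close> vanished at \<open>x0\<close>, the unit vector of
    \<open>j\<close> would lie in the kernel there.\<close>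
  obtain s where s: "s \<in> S" "a s j x0 \<noteq> 0"
  proof (rule ccontr)
    assume "\<not> thesis"
    then have *: "\<And>s. s \<in> S \<Longrightarrow> a s j x0 = 0" using that by blast
    have "\<forall>k\<in>insert j J. (if k = j then 1 else 0::real) = 0"
      by (rule insert.prems(2)) (use insert.hyps * in \<open>auto simp: if_distrib cong: if_cong\<close>)
    then show False by simp
  qed
  have piv: "a s j x \<noteq> 0"
    using assms(4) insert.prems(1)[OF s(1), of j] s(2) unfolding generic_point_def by auto
  define b where "b = (\<lambda>t k x. a s j x * a t k x - a t j x * a s k x)"
  have b: "(\<Sum>k\<in>J. b t k y * w k)
      = a s j y * (\<Sum>k\<in>J. a t k y * w k) - a t j y * (\<Sum>k\<in>J. a s k y * w k)" for t y and w :: "_ \<Rightarrow> real"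
    by (simp add: b_def sum_subtractf[symmetric] sum_distrib_left algebra_simps)
  have "\<forall>k\<in>J. m k = 0"
  proof (rule insert.IH)
    show "b t k \<in> polys K I" if "t \<in> S" "k \<in> J" for t k
      unfolding b_def using insert.prems(1) s that assms(2) by (auto intro!: polys_diff polys_mult)
    show "(\<Sum>k\<in>J. b t k x * m k) = 0" if "t \<in> S" for t
    proof -
      have "a t j x * m j + (\<Sum>k\<in>J. a t k x * m k) = 0" "a s j x * m j + (\<Sum>k\<in>J. a s k x * m k) = 0"
        using insert.prems(3)[OF that] insert.prems(3)[OF s(1)] insert.hyps by auto
      then have "(\<Sum>k\<in>J. a t k x * m k) = - a t j x * m j" "(\<Sum>k\<in>J. a s k x * m k) = - a s j x * m j"
        by linarith+
      then show ?thesis unfolding b by simp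
    qed
    fix w assume w: "\<And>t. t \<in> S \<Longrightarrow> (\<Sum>k\<in>J. b t k x0 * w k) = 0"
    define w' where "w' = w(j := - (\<Sum>k\<in>J. a s k x0 * w k) / a s j x0)"
    have sum: "(\<Sum>k\<in>insert j J. a t k x0 * w' k) = a t j x0 * w' j + (\<Sum>k\<in>J. a t k x0 * w k)" for t
    proof -
      have "(\<Sum>k\<in>J. a t k x0 * w' k) = (\<Sum>k\<in>J. a t k x0 * w k)"
        by (rule sum.cong) (use insert.hyps in \<open>auto simp: w'_def\<close>)
      then show ?thesis using insert.hyps by simp
    qed
    have "\<forall>k\<in>insert j J. w' k = 0"
    proof (rule insert.prems(2))
      fix t assume "t \<in> S"
      have "a s j x0 * (\<Sum>k\<in>insert j J. a t k x0 * w' k) = (\<Sum>k\<in>J. b t k x0 * w k)"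
        unfolding sum b using s(2) by (simp add: w'_def ring_distribs)
      then show "(\<Sum>k\<in>insert j J. a t k x0 * w' k) = 0" using w[OF \<open>t \<in> S\<close>] s(2) by simp
    qed
    then show "\<forall>k\<in>J. w k = 0" using insert.hyps by (auto simp: w'_def split: if_splits)
  qed
  then have "a s j x * m j = 0" using insert.prems(3)[OF s(1)] insert.hyps by simp
  then show ?case using piv \<open>\<forall>k\<in>J. m k = 0\<close> by simp
qed

section \<open>Fibres through generic points\<close>

text \<open>If \<open>f\<close> is algebraic over the values at \<open>p\<close> of the functions in \<open>S\<close>, differentiate its
  minimal relation: a direction that annihilates every gradient in \<open>S\<close> annihilates that of \<open>f\<close>.\<close>

lemma derivative_zero_of_dependent:
  assumes "generic_point \<rat> I p" "S \<subseteq> polys \<rat> I" "f \<in> polys \<rat> I"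
    and S: "generic_point \<rat> S (\<lambda>s. s p)" and f: "\<not> generic_point \<rat> (insert f S) (\<lambda>s. s p)"
    and m: "\<And>s. s \<in> S \<Longrightarrow> ((\<lambda>t. s (\<lambda>i. p i + t * m i)) has_real_derivative 0) (at 0)"
    and df: "((\<lambda>t. f (\<lambda>i. p i + t * m i)) has_real_derivative df) (at 0)"
  shows "df = 0"
proof -
  define ev where "ev = (\<lambda>s :: ('a \<Rightarrow> real) \<Rightarrow> real. s p)"
  \<comment> \<open>Coefficients are kept in the ring of values at \<open>p\<close> instead of its
    fraction field; this is enough for the minimality argument, since \<open>pderiv U\<close> has
    its coefficients in the same ring.\<close>
  define R where "R = {U :: real poly. \<forall>k. coeff U k \<in> (\<lambda>c. c ev) ` polys \<rat> S}"
  have "\<exists>U. U \<in> R \<and> U \<noteq> 0 \<and> poly U (f p) = 0"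
  proof -
    obtain g z0 where g: "g \<in> polys \<rat> (insert f S)" "g ev = 0" "g z0 \<noteq> 0"
      using f unfolding generic_point_def ev_def by auto
    obtain n c where c: "\<And>k. c k \<in> polys \<rat> S" "\<And>z. g z = (\<Sum>k<n. c k z * z f ^ k)"
      by (rule polys_insert_expand[OF Rats_0 Rats_1 g(1)]) (rule that)
    define U where "U = (\<Sum>k<n. monom (c k ev) k)"
    have coeff: "coeff U k = (if k < n then c k ev else 0)" for k
      unfolding U_def by (simp add: coeff_sum)
    have "coeff U k \<in> (\<lambda>c. c ev) ` polys \<rat> S" for k
    proof (cases "k < n")
      case True
      then show ?thesis using c(1) coeff by auto
    next
      case False
      then show ?thesis using polys_const[of 0 \<rat> S] coeff by (intro image_eqI[of _ _ "\<lambda>x. 0"]) auto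
    qed
    then have "U \<in> R" unfolding R_def by blast
    moreover have "U \<noteq> 0"
    proof
      assume "U = 0"
      then have "c k ev = 0" if "k < n" for k
        using coeff[of k] that by simp
      then have "c k z0 = 0" if "k < n" for k
        using that generic_pointD[OF S c(1)] unfolding ev_def by simp
      then show False using g(3) c(2) by simp
    qed
    moreover have "poly U (f p) = 0"
      using g(2) unfolding U_def c(2) by (simp add: poly_sum poly_monom ev_def)
    ultimately show ?thesis by blast
  qed
  from ex_has_least_nat[where P = "\<lambda>U. U \<in> R \<and> U \<noteq> 0 \<and> poly U (f p) = 0" and m = degree] this
  obtain U where U: "U \<in> R" "U \<noteq> 0" "poly U (f p) = 0"
    and min: "\<And>V. V \<in> R \<Longrightarrow> V \<noteq> 0 \<Longrightarrow> poly V (f p) = 0 \<Longrightarrow> degree U \<le> degree V"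
    by blast
  have deg: "degree U \<noteq> 0"
  proof
    assume "degree U = 0"
    then obtain u where "U = [:u:]" by (rule degree_eq_zeroE)
    with U(2,3) show False by simp
  qed
  have "\<forall>k. \<exists>c. c \<in> polys \<rat> S \<and> coeff U k = c ev"
    using U(1) unfolding R_def by auto
  from choice[OF this] obtain c where c: "\<And>k. c k \<in> polys \<rat> S" "\<And>k. coeff U k = c k ev"
    by blast
  have "coeff (pderiv U) k \<in> (\<lambda>c. c ev) ` polys \<rat> S" for k
  proof (rule image_eqI)
    show "coeff (pderiv U) k = of_nat (Suc k) * c (Suc k) ev" by (simp add: coeff_pderiv c(2))
    show "(\<lambda>x. of_nat (Suc k) * c (Suc k) x) \<in> polys \<rat> S"
      using c(1) by (intro polys_mult polys_const) auto
  qed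
  then have "pderiv U \<in> R" unfolding R_def by blast
  moreover have "pderiv U \<noteq> 0" "degree (pderiv U) < degree U"
    using deg by (auto simp: pderiv_eq_0_iff degree_pderiv)
  ultimately have U': "poly (pderiv U) (f p) \<noteq> 0"
    using min[of "pderiv U"] by auto
  \<comment> \<open>The relation with its coefficients read as functions of \<open>x\<close>: it
    holds at the generic \<open>p\<close>, hence identically, and can be differentiated.\<close>
  define h where "h = (\<lambda>x. \<Sum>k\<le>degree U. c k (\<lambda>s. s x) * f x ^ k)"
  have "(\<lambda>x. c k (\<lambda>s. s x)) \<in> polys \<rat> I" for k
    using c(1) by (rule polys_compose) (use assms(2) in auto)
  then have "(\<lambda>x. c k (\<lambda>s. s x) * f x ^ k) \<in> polys \<rat> I" for k
    using polys_power[OF Rats_1 assms(3)] by (rule polys_mult)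
  then have "h \<in> polys \<rat> I"
    unfolding h_def by (intro polys_sum) auto
  moreover have "h p = 0"
    using U(3) unfolding h_def poly_altdef by (simp add: c(2) ev_def)
  ultimately have h0: "h x = 0" for x
    by (rule generic_pointD[OF assms(1)])
  define phi where "phi = (\<lambda>t. f (\<lambda>i. p i + t * m i))"
  have phi0: "phi 0 = f p" by (simp add: phi_def)
  have dphi: "(phi has_real_derivative df) (at 0)" using df by (simp add: phi_def)
  have pw: "((\<lambda>t. phi t ^ k) has_real_derivative of_nat k * (df * phi 0 ^ (k - Suc 0))) (at 0)" for k
    using DERIV_power[OF dphi, of k] by simp
  have dc: "((\<lambda>t. c k (\<lambda>s. s (\<lambda>i. p i + t * m i))) has_real_derivative 0) (at 0)" for k
    by (rule polys_derivative_zero[OF c(1)]) (use m in auto)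
  have "((\<lambda>t. \<Sum>k\<le>degree U. c k (\<lambda>s. s (\<lambda>i. p i + t * m i)) * phi t ^ k)
      has_real_derivative (\<Sum>k\<le>degree U. coeff U k * (of_nat k * (df * phi 0 ^ (k - Suc 0))))) (at 0)"
  proof (rule DERIV_sum)
    fix k
    show "((\<lambda>t. c k (\<lambda>s. s (\<lambda>i. p i + t * m i)) * phi t ^ k)
      has_real_derivative coeff U k * (of_nat k * (df * phi 0 ^ (k - Suc 0)))) (at 0)"
      using DERIV_mult[OF dc[of k] pw[of k]] by (simp add: c(2) ev_def mult_ac)
  qed
  then have "((\<lambda>t. 0) has_real_derivative (\<Sum>k\<le>degree U. coeff U k * (of_nat k * (df * phi 0 ^ (k - Suc 0))))) (at 0)"
    using h0 unfolding h_def phi_def by simp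
  then have "(\<Sum>k\<le>degree U. coeff U k * (of_nat k * (df * phi 0 ^ (k - Suc 0)))) = 0"
    using DERIV_const DERIV_unique by blast
  \<comment> \<open>Along \<open>m\<close> the coefficients are stationary, so differentiating
    \<open>h\<close> amounts to differentiating \<open>U\<close> with constant coefficients along
    \<open>phi\<close>.\<close>
  moreover have "((\<lambda>t. \<Sum>k\<le>degree U. coeff U k * phi t ^ k)
      has_real_derivative (\<Sum>k\<le>degree U. coeff U k * (of_nat k * (df * phi 0 ^ (k - Suc 0))))) (at 0)"
    by (intro DERIV_sum DERIV_cmult pw)
  ultimately have "((\<lambda>t. poly U (phi t)) has_real_derivative 0) (at 0)"
    by (simp add: poly_altdef)
  moreover have "((\<lambda>t. poly U (phi t)) has_real_derivative poly (pderiv U) (f p) * df) (at 0)"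
    using DERIV_chain2[OF poly_DERIV dphi] phi0 by simp
  ultimately have "poly (pderiv U) (f p) * df = 0" using DERIV_unique by blast
  then show ?thesis using U' by simp
qed

text \<open>The values \<open>f p\<close> with \<open>f \<in> \<Phi>\<close> have transcendence degree \<open>card I\<close>, hence every coordinate of a
  point in the fibre through \<open>p\<close> is algebraic over them.\<close>

theorem finite_fibre:
  assumes "finite I" "generic_point \<rat> I p" "finite \<Phi>" "\<Phi> \<subseteq> polys \<rat> I"
    and inj: "\<And>m. (\<And>f. f \<in> \<Phi> \<Longrightarrow> ((\<lambda>t. f (\<lambda>i. x0 i + t * m i)) has_real_derivative 0) (at 0))
      \<Longrightarrow> \<forall>i\<in>I. m i = 0"
    and i: "i \<in> I"
  shows "finite {q i |q. \<forall>f\<in>\<Phi>. f q = f p}"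
proof -
  have "\<forall>f\<in>\<Phi>. \<exists>a. (\<forall>i\<in>I. a i \<in> polys \<rat> I) \<and>
    (\<forall>x m. ((\<lambda>t. f (\<lambda>i. x i + t * m i)) has_real_derivative (\<Sum>i\<in>I. a i x * m i)) (at 0))"
    using polys_directional_derivative[OF assms(1)] assms(4) by blast
  from bchoice[OF this] obtain a where a: "\<And>f i. f \<in> \<Phi> \<Longrightarrow> i \<in> I \<Longrightarrow> a f i \<in> polys \<rat> I"
    and da: "\<And>f x m. f \<in> \<Phi> \<Longrightarrow>
      ((\<lambda>t. f (\<lambda>i. x i + t * m i)) has_real_derivative (\<Sum>i\<in>I. a f i x * m i)) (at 0)"
    by blast
  \<comment> \<open>Gradient entries are rational polynomials, so injectivity moves from
    \<open>x0\<close> to the generic point \<open>p\<close>.\<close>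
  have inj_p: "\<forall>i\<in>I. m i = 0" if "\<And>f. f \<in> \<Phi> \<Longrightarrow> (\<Sum>i\<in>I. a f i p * m i) = 0" for m
  proof (rule injective_at_generic_point[OF assms(1) _ a assms(2) _ that])
    fix m assume z: "\<And>f. f \<in> \<Phi> \<Longrightarrow> (\<Sum>i\<in>I. a f i x0 * m i) = 0"
    show "\<forall>i\<in>I. m i = 0"
    proof (rule inj)
      fix f assume f: "f \<in> \<Phi>"
      show "((\<lambda>t. f (\<lambda>i. x0 i + t * m i)) has_real_derivative 0) (at 0)"
        using da[OF f, of x0 m] unfolding z[OF f] .
    qed
  qed auto
  define ev where "ev = (\<lambda>s :: ('a \<Rightarrow> real) \<Rightarrow> real. s p)"
  \<comment> \<open>By maximality the values of \<open>S\<close> form a transcendence basis for the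
    values of \<open>\<Phi>\<close>.\<close>
  obtain S where S: "S \<subseteq> \<Phi>" "generic_point \<rat> S ev"
    and max: "\<And>f. f \<in> \<Phi> - S \<Longrightarrow> \<not> generic_point \<rat> (insert f S) ev"
  proof -
    let ?A = "{S. S \<subseteq> \<Phi> \<and> generic_point \<rat> S ev}"
    have "finite ?A" using assms(3) by simp
    moreover have "?A \<noteq> {}" using generic_point_empty by blast
    ultimately obtain S where S: "S \<in> ?A" "\<forall>T\<in>?A. S \<subseteq> T \<longrightarrow> S = T"
      using finite_has_maximal by meson
    have "\<not> generic_point \<rat> (insert f S) ev" if "f \<in> \<Phi> - S" for f
      using S that by blast
    then show ?thesis using that S(1) by blast
  qed
  have fin_S: "finite S" using S(1) assms(3) finite_subset by blast
  have SI: "S \<subseteq> polys \<rat> I" using S(1) assms(4) by auto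
  \<comment> \<open>With fewer than \<open>card I\<close> functions some nonzero direction would
    annihilate all their gradients, hence by dependence every gradient of \<open>\<Phi>\<close>,
    against injectivity.\<close>
  have card: "card I \<le> card S"
  proof (rule ccontr)
    assume "\<not> card I \<le> card S"
    then obtain m where m: "\<exists>i\<in>I. m i \<noteq> 0" "\<And>s. s \<in> S \<Longrightarrow> (\<Sum>i\<in>I. a s i p * m i) = 0"
      using homogeneous_system_nontrivial[OF fin_S assms(1), of "\<lambda>s i. a s i p"] by auto
    have "(\<Sum>i\<in>I. a f i p * m i) = 0" if "f \<in> \<Phi>" for f
    proof (cases "f \<in> S")
      case False
      then have "\<not> generic_point \<rat> (insert f S) ev" using that max by blast
      moreover have "((\<lambda>t. s (\<lambda>i. p i + t * m i)) has_real_derivative 0) (at 0)" if "s \<in> S" for s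
        using da[of s p m] m(2)[OF that] that S(1) by auto
      ultimately show ?thesis
        using derivative_zero_of_dependent[where f = f and m = m, OF assms(2) SI _ _ _ _ da[OF that]]
          S(2) that assms(4) unfolding ev_def by blast
    qed (use m in auto)
    with inj_p m(1) show False by blast
  qed
  define X where "X = (\<lambda>x :: 'a \<Rightarrow> real. x i)"
  show ?thesis
  proof (cases "X \<in> S")
    case True
    then have "{q i |q. \<forall>f\<in>\<Phi>. f q = f p} \<subseteq> {p i}"
      using S(1) unfolding X_def by auto
    then show ?thesis using finite_subset by blast
  next
    case False
    \<comment> \<open>\<open>X\<close> and \<open>S\<close> are more polynomials than there are
      variables, so they satisfy an identity \<open>g\<close>. Unlike a relation at \<open>p\<close>
      alone, it also holds at every \<open>q\<close> of the fibre, where the functions in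
      \<open>S\<close> keep their values; so \<open>q i\<close> is a root of a fixed
      polynomial.\<close>
    have "card I < card (insert X S)" using False card fin_S by simp
    moreover have "insert X S \<subseteq> polys \<rat> I" using SI i by (auto simp: X_def intro: polys_var)
    moreover have "finite (insert X S)" using fin_S by simp
    ultimately obtain g where g: "g \<in> polys \<rat> (insert X S)" "\<exists>z. g z \<noteq> 0" "\<And>x. g (\<lambda>s. s x) = 0"
      using polys_algebraically_dependent[OF assms(1)] by metis
    then obtain z0 where z0: "g z0 \<noteq> 0" by blast
    obtain n c where c: "\<And>k. c k \<in> polys \<rat> S" "\<And>z. g z = (\<Sum>k<n. c k z * z X ^ k)"
      by (rule polys_insert_expand[OF Rats_0 Rats_1 g(1)]) (rule that)
    define U where "U = (\<Sum>k<n. monom (c k ev) k)"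
    have "U \<noteq> 0"
    proof
      assume "U = 0"
      have "c k ev = 0" if "k < n" for k
        using arg_cong[OF \<open>U = 0\<close>, of "\<lambda>p. coeff p k"] that unfolding U_def
        by (simp add: coeff_sum)
      then have "c k z0 = 0" if "k < n" for k
        using that generic_pointD[OF S(2) c(1)] by simp
      then show False using z0 c(2) by simp
    qed
    moreover have "{q i |q. \<forall>f\<in>\<Phi>. f q = f p} \<subseteq> {t. poly U t = 0}"
    proof clarify
      fix q assume q: "\<forall>f\<in>\<Phi>. f q = f p"
      have "c k (\<lambda>s. s q) = c k ev" for k
        by (rule polys_cong[OF c(1)]) (use q S(1) in \<open>auto simp: ev_def\<close>)
      then show "poly U (q i) = 0"
        using g(3)[of q] unfolding c(2) U_def by (simp add: poly_sum poly_monom X_def)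
    qed
    ultimately show ?thesis using poly_roots_finite finite_subset by blast
  qed
qed

section \<open>Generic frameworks\<close>

text \<open>Passes from polynomial functions to the formal polynomials in the definition of
  genericity: an expression that evaluates to zero everywhere has zero coefficients by
  \<open>monomials_independent\<close>.\<close>

lemma generic_realization_of_generic_point:
  fixes x :: "'w \<times> 'd::finite \<Rightarrow> real"
  assumes "finite W" "generic_point \<rat> (W \<times> UNIV) x"
  shows "generic_realization W (\<lambda>w. \<chi> k. x (w, k))"
  unfolding generic_realization_def alg_independent_over_rat_def
proof (intro allI impI)
  fix P :: "('w \<times> 'd \<Rightarrow>\<^sub>0 nat) \<Rightarrow>\<^sub>0 rat"
  define I where "I = W \<times> (UNIV :: 'd set)"
  assume "\<forall>m\<in>Poly_Mapping.keys P. Poly_Mapping.keys m \<subseteq> W \<times> UNIV"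
  then have keys: "Poly_Mapping.keys m \<subseteq> I" if "m \<in> Poly_Mapping.keys P" for m
    using that by (simp add: I_def)
  assume "eval_poly (\<lambda>(w, i). (\<chi> k. x (w, k)) $ i) P = 0"
  then have zero: "eval_poly x P = 0" by (simp add: case_prod_beta')
  have "(\<lambda>z. \<Prod>i\<in>Poly_Mapping.keys m. z i ^ Poly_Mapping.lookup m i) \<in> polys \<rat> I"
    if m: "m \<in> Poly_Mapping.keys P" for m
  proof (rule polys_prod[OF Rats_1])
    fix i assume "i \<in> Poly_Mapping.keys m"
    then have "i \<in> I" using keys[OF m] by blast
    then show "(\<lambda>z. z i ^ Poly_Mapping.lookup m i) \<in> polys \<rat> I"
      by (intro polys_power[OF Rats_1] polys_var)
  qed
  then have "(\<lambda>z. eval_poly z P) \<in> polys \<rat> I"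
    unfolding eval_poly_def by (intro polys_sum polys_mult polys_const) auto
  then have "eval_poly z P = 0" for z
    by (rule generic_pointD[OF assms(2)[folded I_def]]) (fact zero)
  moreover have "(\<Prod>i\<in>Poly_Mapping.keys m. z i ^ Poly_Mapping.lookup m i)
      = (\<Prod>i\<in>I. z i ^ Poly_Mapping.lookup m i)" if "m \<in> Poly_Mapping.keys P" for m and z :: "_ \<Rightarrow> real"
    by (rule prod.mono_neutral_left)
      (use keys[OF that] assms(1) in \<open>auto simp: I_def in_keys_iff\<close>)
  ultimately have "(\<Sum>m\<in>Poly_Mapping.keys P. of_rat (Poly_Mapping.lookup P m) *
      (\<Prod>i\<in>I. z i ^ Poly_Mapping.lookup m i)) = (0::real)" for z :: "_ \<Rightarrow> real"
    unfolding eval_poly_def by simp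
  moreover have "m = m'" if "m \<in> Poly_Mapping.keys P" "m' \<in> Poly_Mapping.keys P"
    "\<And>i. i \<in> I \<Longrightarrow> Poly_Mapping.lookup m i = Poly_Mapping.lookup m' i" for m m'
  proof (rule poly_mapping_eqI)
    fix i show "Poly_Mapping.lookup m i = Poly_Mapping.lookup m' i"
    proof (cases "i \<in> I")
      case False
      then have "i \<notin> Poly_Mapping.keys m" "i \<notin> Poly_Mapping.keys m'"
        using keys that(1,2) by blast+
      then show ?thesis by (simp add: in_keys_iff)
    qed (use that in simp)
  qed
  ultimately have "\<forall>m\<in>Poly_Mapping.keys P. of_rat (Poly_Mapping.lookup P m) = (0::real)"
    using monomials_independent[where e = Poly_Mapping.lookup and I = I and M = "Poly_Mapping.keys P"
        and c = "\<lambda>m. of_rat (Poly_Mapping.lookup P m)"] assms(1) by (simp add: I_def)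
  then show "P = 0" by (intro poly_mapping_eqI) (auto simp: in_keys_iff)
qed

text \<open>Affine spanning in the form of a kernel condition, so that
  \<open>injective_at_generic_point\<close> applies and velocities can be shown to vanish
  directly.\<close>

definition affinely_spanning :: "'j set \<Rightarrow> ('j \<Rightarrow> 'a::real_inner) \<Rightarrow> bool" where
  "affinely_spanning J s \<longleftrightarrow> (\<forall>w. (\<forall>i\<in>J. \<forall>j\<in>J. w \<bullet> (s i - s j) = 0) \<longrightarrow> w = 0)"

lemma affinely_spanningD:
  assumes "affinely_spanning J s" "c \<in> J" "\<And>i. i \<in> J \<Longrightarrow> w \<bullet> (s i - s c) = 0"
  shows "w = 0"
proof -
  have "w \<bullet> (s i - s j) = 0" if "i \<in> J" "j \<in> J" for i j
    using assms(3)[OF that(1)] assms(3)[OF that(2)] by (simp add: inner_diff_right)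
  then show ?thesis using assms(1) unfolding affinely_spanning_def by blast
qed

lemma norm_eq_iff_inner: "norm x = norm y \<longleftrightarrow> x \<bullet> x = y \<bullet> y"
  by (simp add: norm_eq_sqrt_inner)

text \<open>Subtracting two of the squared distance equations cancels the quadratic terms and leaves
  \<open>y - x\<close> orthogonal to \<open>s i - s j\<close>.\<close>

lemma eq_if_equidistant:
  assumes "affinely_spanning J s" "\<And>i. i \<in> J \<Longrightarrow> norm (y - s i) = norm (x - s i)"
  shows "y = x"
proof -
  have eq: "2 * ((y - x) \<bullet> s i) = y \<bullet> y - x \<bullet> x" if "i \<in> J" for i
    using assms(2)[OF that] unfolding norm_eq_iff_inner
    by (simp add: inner_diff_left inner_diff_right inner_commute)
  then have "(y - x) \<bullet> (s i - s j) = 0" if "i \<in> J" "j \<in> J" for i j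
    using eq[OF that(1)] eq[OF that(2)] by (simp add: inner_diff_right)
  then have "y - x = 0" using assms(1) unfolding affinely_spanning_def by blast
  then show ?thesis by simp
qed

text \<open>Distances determine the inner products of the difference vectors, so matching a basis
  chosen among them extends to an orthogonal map; \<open>g\<close> is its inverse between two
  translations.\<close>

lemma isometry_onto_congruent:
  fixes s t :: "'j \<Rightarrow> 'a::euclidean_space"
  assumes span: "affinely_spanning J s" and c: "c \<in> J"
    and iso: "\<And>i j. i \<in> J \<Longrightarrow> j \<in> J \<Longrightarrow> norm (t i - t j) = norm (s i - s j)"
  obtains g :: "'a \<Rightarrow> 'a" where "\<And>x y. norm (g x - g y) = norm (x - y)" "\<And>i. i \<in> J \<Longrightarrow> g (t i) = s i"
proof -
  define b where "b = (\<lambda>i. s i - s c)"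
  define u where "u = (\<lambda>i. t i - t c)"
  have inner: "u i \<bullet> u j = b i \<bullet> b j" if "i \<in> J" "j \<in> J" for i j
  proof -
    have "v \<bullet> w = (v \<bullet> v + w \<bullet> w - (v - w) \<bullet> (v - w)) / 2" for v w :: 'a
      by (simp add: inner_diff_left inner_diff_right inner_commute)
    moreover have "(b i - b j) \<bullet> (b i - b j) = (u i - u j) \<bullet> (u i - u j)"
      using iso[OF that] unfolding norm_eq_iff_inner by (simp add: b_def u_def)
    moreover have "b k \<bullet> b k = u k \<bullet> u k" if "k \<in> J" for k
      using iso[OF that c] unfolding norm_eq_iff_inner by (simp add: b_def u_def)
    ultimately show ?thesis using that by metis
  qed
  have "span (b ` J) = UNIV"
  proof (rule ccontr)
    assume "span (b ` J) \<noteq> UNIV"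
    then obtain a where a: "a \<noteq> 0" "\<forall>x\<in>span (b ` J). a \<bullet> x = 0"
      using span_not_UNIV_orthogonal by blast
    then have "a \<bullet> (s i - s c) = 0" if "i \<in> J" for i
      using that span_base[of "b i" "b ` J"] by (simp add: b_def)
    then show False using affinely_spanningD[OF span c] a(1) by blast
  qed
  obtain B where B: "B \<subseteq> b ` J" "independent B" "b ` J \<subseteq> span B"
    by (rule maximal_independent_subset)
  have span_B: "span B = UNIV"
    using span_mono[OF B(3)] \<open>span (b ` J) = UNIV\<close> by (auto simp: span_span)
  from B(1) have "\<forall>v\<in>B. \<exists>i. i \<in> J \<and> b i = v" by auto
  from bchoice[OF this] obtain idx where idx: "\<And>v. v \<in> B \<Longrightarrow> idx v \<in> J \<and> b (idx v) = v" by blast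
  obtain f where f: "linear f" "\<forall>v\<in>B. f v = u (idx v)"
    using linear_independent_extend[OF B(2), of "\<lambda>v. u (idx v)"] by blast
  have ff: "f x \<bullet> f y = x \<bullet> y" for x y
  proof -
    have BB: "f v \<bullet> f w = v \<bullet> w" if "v \<in> B" "w \<in> B" for v w
      using that f(2) inner idx by metis
    have By: "f v \<bullet> f y = v \<bullet> y" if "v \<in> B" for v y
    proof -
      have "y \<in> span B" using span_B by simp
      then show ?thesis
      proof (induction rule: span_induct_alt)
        case base
        then show ?case using f(1) by (simp add: linear_0)
      next
        case (step r z y)
        then show ?case using BB[OF that step(1)] f(1)
          by (simp add: linear_add linear_scale inner_add_right)
      qed
    qed
    have "x \<in> span B" using span_B by simp
    then show ?thesis
    proof (induction rule: span_induct_alt)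
      case base
      then show ?case using f(1) by (simp add: linear_0)
    next
      case (step r z x)
      then show ?case using By[OF step(1)] f(1) by (simp add: linear_add linear_scale inner_add_left)
    qed
  qed
  have orth: "orthogonal_transformation f"
    unfolding orthogonal_transformation_def using f(1) ff by blast
  have fb: "f (b i) = u i" if i: "i \<in> J" for i
  proof -
    have "(f (b i) - u i) \<bullet> f y = 0" for y
    proof -
      have "y \<in> span B" using span_B by simp
      then show ?thesis
      proof (induction rule: span_induct_alt)
        case base
        then show ?case using f(1) by (simp add: linear_0)
      next
        case (step r v y)
        have "f (b i) \<bullet> f v = b i \<bullet> v" by (rule ff)
        moreover have "u i \<bullet> f v = b i \<bullet> v"
          using idx[OF step(1)] f(2) step(1) inner[OF i, of "idx v"] by auto
        ultimately show ?case using step f(1)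
          by (simp add: linear_add linear_scale inner_add_right inner_diff_left)
      qed
    qed
    \<comment> \<open>\<open>f (b i)\<close> and \<open>u i\<close> have the same norm and their
      difference is orthogonal to \<open>f (b i)\<close>, which forces equality.\<close>
    then have "f (b i) \<bullet> f (b i) = u i \<bullet> f (b i)" by (simp add: inner_diff_left)
    then have "(f (b i) - u i) \<bullet> (f (b i) - u i) = 0"
      using inner[OF i i] ff[of "b i" "b i"] by (simp add: inner_diff_left inner_diff_right inner_commute)
    then show ?thesis by simp
  qed
  define g where "g = (\<lambda>x. inv f (x - t c) + s c)"
  have orth': "orthogonal_transformation (inv f)" by (rule orthogonal_transformation_inv[OF orth])
  have "norm (g x - g y) = norm (x - y)" for x y
  proof -
    have "g x - g y = inv f (x - y)"
      using linear_diff[OF orthogonal_transformation_linear[OF orth'], of "x - t c" "y - t c"]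
      by (simp add: g_def)
    then show ?thesis using orthogonal_transformation_norm[OF orth'] by simp
  qed
  moreover have "g (t i) = s i" if "i \<in> J" for i
  proof -
    have "inv f (u i) = b i"
      using fb[OF that] orthogonal_transformation_inj[OF orth] by (metis inv_f_f)
    then show ?thesis by (simp add: g_def u_def b_def)
  qed
  ultimately show ?thesis using that by blast
qed

text \<open>Composing \<open>q\<close> with an isometry changes no distance, and \<open>q\<close> is
  already congruent to \<open>p\<close> on the complete subgraph of the vertices \<open>b i\<close>;
  hence these vertices may be assumed fixed.\<close>

lemma globally_rigid_if_pinned:
  fixes p :: "'w \<Rightarrow> real ^ 'd::finite"
  assumes span: "affinely_spanning J (\<lambda>i. p (b i))" and c: "c \<in> J"
    and edges: "\<And>i j. i \<in> J \<Longrightarrow> j \<in> J \<Longrightarrow> b i \<noteq> b j \<Longrightarrow> {b i, b j} \<in> F"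
    and pinned: "\<And>q w. (\<And>u v. {u, v} \<in> F \<Longrightarrow> norm (q u - q v) = norm (p u - p v)) \<Longrightarrow>
      (\<And>i. i \<in> J \<Longrightarrow> q (b i) = p (b i)) \<Longrightarrow> w \<in> W \<Longrightarrow> q w = p w"
  shows "globally_rigid_framework W F p"
  unfolding globally_rigid_framework_def
proof (intro allI impI ballI)
  fix q :: "'w \<Rightarrow> real ^ 'd" and u v
  assume q: "\<forall>u v. {u, v} \<in> F \<longrightarrow> norm (q u - q v) = norm (p u - p v)" and uv: "u \<in> W" "v \<in> W"
  have "norm (q (b i) - q (b j)) = norm (p (b i) - p (b j))" if "i \<in> J" "j \<in> J" for i j
    using q edges[OF that] by (cases "b i = b j") auto
  then obtain g where g: "\<And>x y. norm (g x - g y) = norm (x - y)" "\<And>i. i \<in> J \<Longrightarrow> g (q (b i)) = p (b i)"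
    by (rule isometry_onto_congruent[OF span c]) (auto intro: that)
  have "g (q w) = p w" if "w \<in> W" for w
    by (rule pinned) (use g q that in auto)
  then show "norm (q u - q v) = norm (p u - p v)" using g(1) uv by metis
qed

lemma finite_vectors:
  fixes Q :: "(real ^ 'd::finite) set"
  assumes "\<And>k. finite ((\<lambda>v. v $ k) ` Q)"
  shows "finite Q"
proof -
  have "(\<lambda>v. vec_nth v) ` Q \<subseteq> PiE UNIV (\<lambda>k. (\<lambda>v. v $ k) ` Q)" by auto
  moreover have "finite (PiE UNIV (\<lambda>k. (\<lambda>v. v $ k) ` Q))" using assms by (intro finite_PiE) auto
  ultimately have "finite ((\<lambda>v. vec_nth v) ` Q)" using finite_subset by blast
  then show ?thesis by (rule finite_imageD) (auto simp: inj_on_def vec_eq_iff)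
qed

abbreviation config :: "('w \<times> 'd::finite \<Rightarrow> real) \<Rightarrow> 'w \<Rightarrow> real ^ 'd" where
  "config x \<equiv> (\<lambda>w. \<chi> k. x (w, k))"

text \<open>Spanning is injectivity of a linear system whose entries are polynomial in the
  coordinates; the points \<open>s\<close> witness it at one configuration.\<close>

lemma affinely_spanning_generic:
  fixes x :: "'w \<times> 'd::finite \<Rightarrow> real" and s :: "'j \<Rightarrow> real ^ 'd"
  assumes "generic_point \<rat> I x" "affinely_spanning J s" "inj_on b J" "b ` J \<times> UNIV \<subseteq> I"
  shows "affinely_spanning J (\<lambda>i. config x (b i))"
  unfolding affinely_spanning_def
proof (intro allI impI)
  fix w :: "real ^ 'd"
  assume w: "\<forall>i\<in>J. \<forall>j\<in>J. w \<bullet> (config x (b i) - config x (b j)) = 0"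
  define a where "a = (\<lambda>(i, j) k (x :: 'w \<times> 'd \<Rightarrow> real). x (b i, k) - x (b j, k))"
  define x0 where "x0 = (\<lambda>(v, k :: 'd). s (inv_into J b v) $ k)"
  have "\<forall>k\<in>(UNIV :: 'd set). w $ k = 0"
  proof (rule injective_at_generic_point[where S = "J \<times> J" and a = a and K = \<rat> and I = I and x = x and ?x0.0 = x0])
    show "a ij k \<in> polys \<rat> I" if "ij \<in> J \<times> J" for ij k
      using that assms(4) unfolding a_def by (auto intro!: polys_diff polys_var)
    show "(\<Sum>k\<in>UNIV. a ij k x * w $ k) = 0" if "ij \<in> J \<times> J" for ij
      using w that by (auto simp: a_def inner_vec_def mult.commute)
    fix m assume m: "\<And>ij. ij \<in> J \<times> J \<Longrightarrow> (\<Sum>k\<in>(UNIV :: 'd set). a ij k x0 * m k) = 0"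
    have "(\<chi> k. m k) \<bullet> (s i - s j) = 0" if "i \<in> J" "j \<in> J" for i j
      using m[of "(i, j)"] that assms(3) by (simp add: a_def x0_def inner_vec_def mult.commute)
    then have "(\<chi> k. m k) = 0" using assms(2) unfolding affinely_spanning_def by blast
    then show "\<forall>k\<in>UNIV. m k = 0" by (simp add: vec_eq_iff)
  qed (use assms(1) in auto)
  then show "w = 0" by (simp add: vec_eq_iff)
qed

text \<open>The measured functions are the coordinates of the pinned vertices \<open>B\<close> and
  the squared lengths of the edges \<open>E\<close>. Up to a factor 2 the derivative of the latter
  at \<open>s\<close> is the expression in \<open>rigid\<close>, so infinitesimal rigidity at one
  placement \<open>s\<close>, however degenerate, is enough.\<close>

theorem framework_finite_fibre:
  fixes x :: "'w \<times> 'd::finite \<Rightarrow> real" and s :: "'w \<Rightarrow> real ^ 'd"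
  assumes "finite W" "generic_point \<rat> (W \<times> UNIV) x" "B \<subseteq> W" "E \<subseteq> W \<times> W"
    and rigid: "\<And>m w. (\<And>w. w \<in> B \<Longrightarrow> m w = 0) \<Longrightarrow>
      (\<And>u v. (u, v) \<in> E \<Longrightarrow> (s u - s v) \<bullet> (m u - m v) = 0) \<Longrightarrow> w \<in> W \<Longrightarrow> m w = 0"
    and w: "w \<in> W"
  shows "finite {q w |q. (\<forall>w\<in>B. q w = config x w) \<and>
    (\<forall>(u, v)\<in>E. norm (q u - q v) = norm (config x u - config x v))}" (is "finite ?Q")
proof (rule finite_vectors)
  fix k :: 'd
  define crd where "crd = (\<lambda>i (y :: 'w \<times> 'd \<Rightarrow> real). y i)"
  define sqd where "sqd = (\<lambda>(u, v) (y :: 'w \<times> 'd \<Rightarrow> real). \<Sum>k\<in>UNIV. (y (u, k) - y (v, k))\<^sup>2)"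
  define \<Phi> where "\<Phi> = crd ` (B \<times> UNIV) \<union> sqd ` E"
  have sqd: "sqd (u, v) y = (norm (config y u - config y v))\<^sup>2" for u v y
    unfolding power2_norm_eq_inner by (simp add: sqd_def inner_vec_def power2_eq_square)
  have "finite {q (w, k) |q. \<forall>f\<in>\<Phi>. f q = f x}"
  proof (rule finite_fibre[where I = "W \<times> UNIV" and ?x0.0 = "\<lambda>(w, k). s w $ k"])
    show "finite \<Phi>"
      using assms(1) finite_subset[OF assms(3)] finite_subset[OF assms(4)]
      by (simp add: \<Phi>_def)
    have "crd ` (B \<times> UNIV) \<subseteq> polys \<rat> (W \<times> UNIV)"
      using assms(3) unfolding crd_def by (auto intro!: polys_var)
    moreover have "sqd e \<in> polys \<rat> (W \<times> UNIV)" if "e \<in> E" for e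
      using that assms(4) unfolding sqd_def
      by (cases e) (auto intro!: polys_sum polys_power polys_diff polys_var)
    ultimately show "\<Phi> \<subseteq> polys \<rat> (W \<times> UNIV)" unfolding \<Phi>_def by auto
    fix m :: "'w \<times> 'd \<Rightarrow> real"
    assume m: "\<And>f. f \<in> \<Phi> \<Longrightarrow>
      ((\<lambda>t. f (\<lambda>i. (case i of (w, k) \<Rightarrow> s w $ k) + t * m i)) has_real_derivative 0) (at 0)"
    have "config m w = 0" if "w \<in> W" for w
    proof (rule rigid[OF _ _ that])
      fix w assume w: "w \<in> B"
      have "m (w, k) = 0" for k
      proof -
        have "crd (w, k) \<in> \<Phi>" using w by (auto simp: \<Phi>_def)
        from m[OF this] have "((\<lambda>t. s w $ k + t * m (w, k)) has_real_derivative 0) (at 0)"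
          by (simp add: crd_def)
        moreover have "((\<lambda>t. s w $ k + t * m (w, k)) has_real_derivative m (w, k)) (at 0)"
          by (auto intro!: derivative_eq_intros)
        ultimately show ?thesis using DERIV_unique by blast
      qed
      then show "config m w = 0" by (simp add: vec_eq_iff)
    next
      fix u v assume uv: "(u, v) \<in> E"
      then have "sqd (u, v) \<in> \<Phi>" by (auto simp: \<Phi>_def)
      from m[OF this] have "((\<lambda>t. \<Sum>k\<in>UNIV. ((s u $ k + t * m (u, k)) - (s v $ k + t * m (v, k)))\<^sup>2)
          has_real_derivative 0) (at 0)"
        by (simp add: sqd_def)
      moreover have "((\<lambda>t. \<Sum>k\<in>UNIV. ((s u $ k + t * m (u, k)) - (s v $ k + t * m (v, k)))\<^sup>2)
          has_real_derivative (\<Sum>k\<in>UNIV. 2 * ((s u $ k - s v $ k) * (m (u, k) - m (v, k))))) (at 0)"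
        by (rule DERIV_sum) (auto intro!: derivative_eq_intros)
      ultimately have "(\<Sum>k\<in>UNIV. 2 * ((s u $ k - s v $ k) * (m (u, k) - m (v, k)))) = 0"
        using DERIV_unique by blast
      then show "(s u - s v) \<bullet> (config m u - config m v) = 0"
        by (simp add: inner_vec_def sum_distrib_left[symmetric])
    qed
    then show "\<forall>i\<in>W \<times> UNIV. m i = 0" by (auto simp: vec_eq_iff)
  qed (use assms w in auto)
  moreover have "(\<lambda>v. v $ k) ` ?Q \<subseteq> {q (w, k) |q. \<forall>f\<in>\<Phi>. f q = f x}"
  proof clarify
    fix q assume q: "\<forall>w\<in>B. q w = config x w" "\<forall>(u, v)\<in>E. norm (q u - q v) = norm (config x u - config x v)"
    have "config (\<lambda>(w, k). q w $ k) = q" by (simp add: vec_eq_iff fun_eq_iff)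
    then have "\<forall>f\<in>\<Phi>. f (\<lambda>(w, k). q w $ k) = f x"
      using q unfolding \<Phi>_def by (auto simp: sqd crd_def)
    then show "\<exists>q'. q w $ k = q' (w, k) \<and> (\<forall>f\<in>\<Phi>. f q' = f x)"
      by (intro exI[of _ "\<lambda>(w, k). q w $ k"]) auto
  qed
  ultimately show "finite ((\<lambda>v. v $ k) ` ?Q)" by (rule finite_subset[rotated])
qed

lemma affinely_spanning_simplex:
  obtains s :: "nat \<Rightarrow> real ^ 'd::finite" where "affinely_spanning {1..CARD('d) + 1} s"
proof -
  obtain h :: "nat \<Rightarrow> 'd" where h: "bij_betw h {1..CARD('d)} UNIV"
    using ex_bij_betw_nat_finite_1[of "UNIV :: 'd set"] by auto
  define s where "s = (\<lambda>i. if i \<le> CARD('d) then axis (h i) (1::real) else 0)"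
  have "affinely_spanning {1..CARD('d) + 1} s"
    unfolding affinely_spanning_def
  proof (intro allI impI)
    fix w assume w: "\<forall>i\<in>{1..CARD('d) + 1}. \<forall>j\<in>{1..CARD('d) + 1}. w \<bullet> (s i - s j) = 0"
    have "w $ k = 0" for k
    proof -
      obtain i where i: "i \<in> {1..CARD('d)}" "h i = k" using h unfolding bij_betw_def by (metis UNIV_I imageE)
      have "w \<bullet> (s i - s (CARD('d) + 1)) = 0" using w i by auto
      then show ?thesis using i by (simp add: s_def inner_axis)
    qed
    then show "w = 0" by (simp add: vec_eq_iff)
  qed
  then show ?thesis using that by blast
qed

section \<open>Body-hinge graphs\<close>

text \<open>What remains of the body-hinge graph when the first hinge vertex of every edge in \<open>M\<close> is
  eliminated, where eliminating a vertex makes its neighbourhood complete.\<close>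

definition merged_verts :: "nat \<Rightarrow> ('v, 'e) multigraph \<Rightarrow> 'e set \<Rightarrow> ('v, 'e) bh_vertex set" where
  "merged_verts d H M = bh_verts d H - (\<lambda>f. Hinge f 1) ` M"

definition merged_edges :: "nat \<Rightarrow> ('v, 'e) multigraph \<Rightarrow> 'e set \<Rightarrow> ('v, 'e) bh_vertex set set" where
  "merged_edges d H M = {X \<in> bh_edges d H. X \<subseteq> merged_verts d H M} \<union>
     {{Body u i, Body v j} |u v i j. (\<exists>f\<in>M. u \<in> ends H f \<and> v \<in> ends H f) \<and>
        i \<in> {1..d+1} \<and> j \<in> {1..d+1} \<and> Body u i \<noteq> (Body v j :: ('v, 'e) bh_vertex)}"

section \<open>Spanning trees and the edges of the simplex\<close>

lemma bij_betw_extending: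
  assumes "finite X" "finite Y" "card X = card Y" "A \<subseteq> X" "B \<subseteq> Y" "card A = card B"
  obtains f where "bij_betw f X Y" "f ` A = B"
proof -
  have fin: "finite A" "finite B" using assms finite_subset by auto
  obtain g where g: "bij_betw g A B" using finite_same_card_bij[OF fin assms(6)] by blast
  have "card (X - A) = card (Y - B)" using assms fin by (simp add: card_Diff_subset)
  then obtain h where h: "bij_betw h (X - A) (Y - B)"
    using finite_same_card_bij assms(1,2) by (metis finite_Diff)
  define f where "f = (\<lambda>x. if x \<in> A then g x else h x)"
  have "bij_betw f A B" using g by (rule iffD1[OF bij_betw_cong, rotated]) (simp add: f_def)
  moreover have "bij_betw f (X - A) (Y - B)" using h by (rule iffD1[OF bij_betw_cong, rotated]) (simp add: f_def)
  ultimately have "bij_betw f (A \<union> (X - A)) (B \<union> (Y - B))"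
    by (rule bij_betw_combine) auto
  moreover have "A \<union> (X - A) = X" "B \<union> (Y - B) = Y" using assms by auto
  ultimately show ?thesis using that \<open>bij_betw f A B\<close> by (metis bij_betw_imp_surj_on)
qed

text \<open>The trees are indexed by the edges \<open>P\<close> of the simplex on \<open>{1..d+1}\<close>, and the hinge vertices are
  placed at vertices of the simplex so that every edge of \<open>H\<close> used by the tree of \<open>P\<close> has a hinge
  vertex in \<open>P\<close>.  For \<open>f \<noteq> e\<close> some tree avoids \<open>f\<close>, and the hinge of \<open>f\<close> is the face opposite to
  the index of that tree.  Three trees avoid \<open>e\<close>; numbering the trees suitably, these are the edges of
  the triangle \<open>{1, 2, 3}\<close>, which leaves room for all hinge vertices of \<open>e\<close> but the first.\<close>

lemma trees_indexed_by_simplex_edges: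
  assumes "d \<ge> 2" "D = (d + 1) choose 2" "e \<in> edges H"
    and "has_disjoint_spanning_trees D (multiply_edges (D - 1) (D - 3) H e)"
  obtains T :: "nat set \<Rightarrow> ('e \<times> nat) set" and pos :: "'e \<Rightarrow> nat \<Rightarrow> nat" where
    "\<And>P. P \<subseteq> {1..d+1} \<Longrightarrow> card P = 2 \<Longrightarrow> spanning_tree (multiply_edges (D - 1) (D - 3) H e) (T P)"
    "\<And>P f j. P \<subseteq> {1..d+1} \<Longrightarrow> card P = 2 \<Longrightarrow> (f, j) \<in> T P \<Longrightarrow>
       \<exists>k\<in>{1..d-1}. (f = e \<longrightarrow> k \<noteq> 1) \<and> pos f k \<in> P"
    "\<And>f k. f \<in> edges H \<Longrightarrow> k \<in> {1..d-1} \<Longrightarrow> pos f k \<in> {1..d+1}"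
proof -
  let ?M = "multiply_edges (D - 1) (D - 3) H e"
  obtain T0 where T0: "\<And>i. i < D \<Longrightarrow> spanning_tree ?M (T0 i)" "disjoint_family_on T0 {..<D}"
    using assms(4) unfolding has_disjoint_spanning_trees_def by blast
  define PP where "PP = {P. P \<subseteq> {1..d+1} \<and> card P = 2}"
  have card_PP: "card PP = D" unfolding PP_def assms(2) by (subst n_subsets) auto
  have fin_PP: "finite PP" unfolding PP_def by (rule finite_subset[of _ "Pow {1..d+1}"]) auto
  have "3 * 2 div 2 \<le> (d + 1) * d div 2" using assms(1) by (intro div_le_mono mult_le_mono) auto
  then have D3: "D \<ge> 3" unfolding assms(2) by (simp add: choose_two)
  define missing where "missing = (\<lambda>f. {i. i < D \<and> (\<forall>j. (f, j) \<notin> T0 i)})"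
  \<comment> \<open>The number of copies of \<open>f\<close>. Disjoint trees use different copies,
    so at least \<open>D - cap f\<close> trees avoid \<open>f\<close>: three for \<open>e\<close>,
    one otherwise.\<close>
  define cap where "cap = (\<lambda>f. if f = e then D - 3 else D - 1)"
  have card_missing: "D - cap f \<le> card (missing f)" if "f \<in> edges H" for f
  proof -
    define used where "used = {i. i < D \<and> (\<exists>j. (f, j) \<in> T0 i)}"
    have "\<forall>i\<in>used. \<exists>j. (f, j) \<in> T0 i" by (auto simp: used_def)
    from bchoice[OF this] obtain c where c: "\<And>i. i \<in> used \<Longrightarrow> (f, c i) \<in> T0 i" by blast
    have "inj_on c used"
    proof (rule inj_onI)
      fix i i' assume i: "i \<in> used" "i' \<in> used" "c i = c i'"
      then have "T0 i \<inter> T0 i' \<noteq> {}" using c[of i] c[of i'] by auto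
      then show "i = i'" using T0(2) i(1,2) unfolding disjoint_family_on_def used_def by auto
    qed
    moreover have "c ` used \<subseteq> {..<cap f}"
    proof clarify
      fix i assume "i \<in> used"
      then have "(f, c i) \<in> edges ?M"
        using c T0(1) unfolding spanning_tree_def used_def by blast
      then show "c i < cap f" by (auto simp: multiply_edges_def cap_def)
    qed
    ultimately have "card used \<le> card {..<cap f}"
      by (rule card_inj_on_le) simp
    then have "card used \<le> cap f" by simp
    moreover have "missing f = {..<D} - used" by (auto simp: missing_def used_def)
    moreover have "used \<subseteq> {..<D}" by (auto simp: used_def)
    ultimately show ?thesis by (simp add: card_Diff_subset finite_subset[OF _ finite_lessThan])
  qed
  have "3 \<le> card (missing e)" using card_missing[OF assms(3)] D3 by (simp add: cap_def)
  then obtain B where B: "B \<subseteq> missing e" "card B = 3" by (meson obtain_subset_with_card_n)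
  define A where "A = {{1, 2}, {1, 3}, {2, 3 :: nat}}"
  have "card A = 3" unfolding A_def by (simp add: doubleton_eq_iff)
  then have cards: "card PP = card {..<D}" "card A = card B" using card_PP B by auto
  have "A \<subseteq> PP" using assms(1) by (auto simp: A_def PP_def)
  moreover have "B \<subseteq> {..<D}" using B by (auto simp: missing_def)
  ultimately obtain \<sigma> where \<sigma>: "bij_betw \<sigma> PP {..<D}" "\<sigma> ` A = B"
    by (rule bij_betw_extending[OF fin_PP finite_lessThan cards(1) _ _ cards(2)])
  have \<sigma>D: "\<sigma> P < D" if "P \<in> PP" for P using \<sigma>(1) that unfolding bij_betw_def by auto
  have "\<exists>P h. P \<in> PP \<and> \<sigma> P \<in> missing f \<and> bij_betw h {1..d-1} ({1..d+1} - P)"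
    if f: "f \<in> edges H" "f \<noteq> e" for f
  proof -
    have "missing f \<noteq> {}" using card_missing[OF f(1)] f(2) D3 by (auto simp: cap_def)
    then obtain i where "i \<in> missing f" by blast
    moreover from this obtain P where "P \<in> PP" "\<sigma> P = i"
      using \<sigma>(1) unfolding missing_def bij_betw_def by (metis (no_types, lifting) imageE lessThan_iff mem_Collect_eq)
    moreover from this have "card ({1..d+1} - P) = card {1..d-1}"
      unfolding PP_def by (auto simp: card_Diff_subset finite_subset)
    then obtain h where "bij_betw h {1..d-1} ({1..d+1} - P)"
      by (metis finite_Diff finite_atLeastAtMost finite_same_card_bij)
    ultimately show ?thesis by blast
  qed
  then have "\<forall>f. \<exists>Ph. f \<in> edges H \<longrightarrow> f \<noteq> e \<longrightarrow>
      fst Ph \<in> PP \<and> \<sigma> (fst Ph) \<in> missing f \<and> bij_betw (snd Ph) {1..d-1} ({1..d+1} - fst Ph)"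
    by simp
  from choice[OF this] obtain Q where Q: "\<And>f. f \<in> edges H \<Longrightarrow> f \<noteq> e \<Longrightarrow> fst (Q f) \<in> PP"
    "\<And>f. f \<in> edges H \<Longrightarrow> f \<noteq> e \<Longrightarrow> \<sigma> (fst (Q f)) \<in> missing f"
    "\<And>f. f \<in> edges H \<Longrightarrow> f \<noteq> e \<Longrightarrow> bij_betw (snd (Q f)) {1..d-1} ({1..d+1} - fst (Q f))"
    by blast
  \<comment> \<open>For \<open>e\<close> the offset 2 puts the hinge vertices
    \<open>2, ..., d - 1\<close> at the simplex vertices \<open>4, ..., d + 1\<close>, exactly those
    outside the triangle, and every \<open>P\<close> other than an edge of the triangle meets them.
    For \<open>f \<noteq> e\<close> the hinge vertices fill all vertices outside the index
    \<open>fst (Q f)\<close> of a tree avoiding \<open>f\<close>.\<close>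
  define pos where "pos = (\<lambda>f k. if f = e then k + 2 else snd (Q f) k)"
  define T where "T = (\<lambda>P. T0 (\<sigma> P))"
  show ?thesis
  proof (rule that[of T pos])
    fix P :: "nat set" assume "P \<subseteq> {1..d+1}" "card P = 2"
    then have P: "P \<in> PP" by (simp add: PP_def)
    show tree: "spanning_tree ?M (T P)" using T0(1)[OF \<sigma>D[OF P]] by (simp add: T_def)
    fix f j assume fj: "(f, j) \<in> T P"
    then have "(f, j) \<in> edges ?M" using tree unfolding spanning_tree_def by blast
    then have f: "f \<in> edges H" by (auto simp: multiply_edges_def)
    have nm: "\<sigma> P \<notin> missing f" using fj by (auto simp: T_def missing_def)
    show "\<exists>k\<in>{1..d-1}. (f = e \<longrightarrow> k \<noteq> 1) \<and> pos f k \<in> P"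
    proof (cases "f = e")
      case True
      then have "P \<notin> A" using nm \<sigma>(2) B by blast
      obtain a b where ab: "P = {a, b}" "a \<noteq> b" using \<open>card P = 2\<close> by (metis card_2_iff)
      have "\<exists>c\<in>P. c \<ge> 4"
      proof (rule ccontr)
        assume "\<not> (\<exists>c\<in>P. c \<ge> 4)"
        then have "a \<in> {1, 2, 3}" "b \<in> {1, 2, 3}" using \<open>P \<subseteq> {1..d+1}\<close> ab by auto
        then have "P \<in> A" using ab by (auto simp: A_def insert_commute)
        with \<open>P \<notin> A\<close> show False by simp
      qed
      then obtain c where c: "c \<in> P" "c \<ge> 4" by blast
      then have "c - 2 \<in> {1..d-1}" "c - 2 \<noteq> 1" "pos f (c - 2) = c"
        using \<open>P \<subseteq> {1..d+1}\<close> True by (auto simp: pos_def)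
      then show ?thesis using c(1) by metis
    next
      case False
      have "P \<noteq> fst (Q f)" using nm Q(2)[OF f False] by auto
      moreover have "card (fst (Q f)) = 2" "finite (fst (Q f))"
        using Q(1)[OF f False] by (auto simp: PP_def finite_subset)
      ultimately have "\<not> P \<subseteq> fst (Q f)" using \<open>card P = 2\<close> card_subset_eq by metis
      then obtain c where c: "c \<in> P" "c \<notin> fst (Q f)" by blast
      then have "c \<in> {1..d+1} - fst (Q f)" using \<open>P \<subseteq> {1..d+1}\<close> by blast
      then obtain k where "k \<in> {1..d-1}" "snd (Q f) k = c"
        using Q(3)[OF f False] unfolding bij_betw_def by (metis (no_types, lifting) imageE)
      then show ?thesis using c(1) False by (auto simp: pos_def)
    qed
  next
    fix f k assume f: "f \<in> edges H" and k: "k \<in> {1..d-1}"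
    show "pos f k \<in> {1..d+1}"
    proof (cases "f = e")
      case False
      then show ?thesis using Q(3)[OF f False] k unfolding bij_betw_def pos_def by auto
    qed (use k in \<open>auto simp: pos_def\<close>)
  qed
qed

lemma connected_by_constant:
  assumes "connected_by M T" "u \<in> verts M" "v \<in> verts M"
    and "\<And>t x y. t \<in> T \<Longrightarrow> ends M t = {x, y} \<Longrightarrow> g x = g y"
  shows "g u = g v"
proof -
  have "(u, v) \<in> {(x, y). \<exists>t\<in>T. ends M t = {x, y}}\<^sup>*"
    using assms unfolding connected_by_def by blast
  then show ?thesis
  proof (induction rule: rtrancl_induct)
    case (step y z)
    then show ?case using assms(4) by auto
  qed simp
qed

section \<open>Partially merged graphs and their rigidity\<close>

context
  fixes H :: "('v, 'e) multigraph"
  assumes H: "finite_multigraph H"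
begin

lemma ends_subset: "f \<in> edges H \<Longrightarrow> v \<in> ends H f \<Longrightarrow> v \<in> verts H"
  using H unfolding finite_multigraph_def by blast

lemma ends_obtain:
  assumes "f \<in> edges H"
  obtains u v where "ends H f = {u, v}" "u \<noteq> v" "u \<in> verts H" "v \<in> verts H"
proof -
  have "card (ends H f) = 2" using H assms unfolding finite_multigraph_def by blast
  then obtain u v where "ends H f = {u, v}" "u \<noteq> v" by (metis card_2_iff)
  then show ?thesis using that ends_subset[OF assms] by blast
qed

lemma finite_merged_verts: "finite (merged_verts d H M)"
proof -
  have "bh_verts d H = (\<lambda>(v, i). Body v i) ` (verts H \<times> {1..d+1}) \<union>
      (\<lambda>(e, j). Hinge e j) ` (edges H \<times> {1..d-1})"
    unfolding bh_verts_def by auto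
  then show ?thesis using H unfolding merged_verts_def finite_multigraph_def by auto
qed

lemma Body_in_merged_verts: "v \<in> verts H \<Longrightarrow> i \<in> {1..d+1} \<Longrightarrow> Body v i \<in> merged_verts d H M"
  by (auto simp: merged_verts_def bh_verts_def)

lemma bh_edges_subset: "X \<in> bh_edges d H \<Longrightarrow> X \<subseteq> bh_verts d H"
  unfolding bh_edges_def bh_verts_def by auto

lemma merged_edges_subset:
  assumes "M \<subseteq> edges H" "X \<in> merged_edges d H M"
  shows "X \<subseteq> merged_verts d H M"
proof -
  consider "X \<subseteq> merged_verts d H M"
    | u v i j f where "X = {Body u i, Body v j}" "f \<in> M" "u \<in> ends H f" "v \<in> ends H f"
      "i \<in> {1..d+1}" "j \<in> {1..d+1}"
    using assms(2) unfolding merged_edges_def by blast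
  then show ?thesis
  proof cases
    case 2
    then have "u \<in> verts H" "v \<in> verts H" using ends_subset assms(1) by blast+
    then show ?thesis using 2 Body_in_merged_verts by simp
  qed
qed

lemma body_edge:
  assumes "v \<in> verts H" "i \<in> {1..d+1}" "j \<in> {1..d+1}" "i \<noteq> j"
  shows "{Body v i, Body v j} \<in> merged_edges d H M"
proof -
  have "{Body v i, Body v j} \<in> bh_edges d H"
    unfolding bh_edges_def
    by (intro UnI1 CollectI exI[of _ v] exI[of _ i] exI[of _ j]) (use assms in auto)
  then show ?thesis using assms Body_in_merged_verts unfolding merged_edges_def by auto
qed

lemma hinge_edge:
  assumes "f \<in> edges H" "v \<in> ends H f" "i \<in> {1..d+1}" "Hinge f k \<in> merged_verts d H M"
  shows "{Body v i, Hinge f k} \<in> merged_edges d H M"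
proof -
  have "k \<in> {1..d-1}" using assms(4) by (auto simp: merged_verts_def bh_verts_def)
  then have "{Body v i, Hinge f k} \<in> bh_edges d H"
    unfolding bh_edges_def
    by (intro UnI2 CollectI exI[of _ v] exI[of _ f] exI[of _ i] exI[of _ k])
      (use assms ends_subset in auto)
  then show ?thesis
    using assms Body_in_merged_verts ends_subset unfolding merged_edges_def by auto
qed

lemma merged_edge:
  assumes "f \<in> M" "u \<in> ends H f" "v \<in> ends H f" "i \<in> {1..d+1}" "j \<in> {1..d+1}" "u \<noteq> v \<or> i \<noteq> j"
  shows "{Body u i, Body v j} \<in> merged_edges d H M"
  unfolding merged_edges_def
  by (intro UnI2 CollectI exI[of _ u] exI[of _ v] exI[of _ i] exI[of _ j]) (use assms in auto)

lemma body_affinely_spanning: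
  fixes x :: "('v, 'e) bh_vertex \<times> 'd::finite \<Rightarrow> real"
  assumes "d = CARD('d)" "generic_point \<rat> (merged_verts d H M \<times> UNIV) x" "v \<in> verts H"
  shows "affinely_spanning {1..d+1} (\<lambda>i. config x (Body v i))"
proof -
  obtain s :: "nat \<Rightarrow> real ^ 'd" where "affinely_spanning {1..d+1} s"
    using affinely_spanning_simplex unfolding assms(1) by blast
  then show ?thesis
    by (rule affinely_spanning_generic[OF assms(2)])
      (use Body_in_merged_verts[OF assms(3)] in \<open>auto simp: inj_on_def\<close>)
qed

text \<open>The bodies of adjacent vertices form one complete graph, so being in place spreads along
  paths of \<open>H\<close>; every remaining hinge vertex is then located by a body at an end of its
  edge.\<close>

lemma globally_rigid_base:
  fixes x :: "('v, 'e) bh_vertex \<times> 'd::finite \<Rightarrow> real"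
  assumes CARD: "d = CARD('d)" and x: "generic_point \<rat> (merged_verts d H (edges H) \<times> UNIV) x"
    and conn: "\<And>u v. u \<in> verts H \<Longrightarrow> v \<in> verts H \<Longrightarrow> (u, v) \<in> {(x, y). \<exists>f\<in>edges H. ends H f = {x, y}}\<^sup>*"
  shows "globally_rigid_framework (merged_verts d H (edges H)) (merged_edges d H (edges H)) (config x)"
proof (cases "verts H = {}")
  case True
  then have "edges H = {}" using ends_obtain by (metis all_not_in_conv)
  with True show ?thesis
    unfolding globally_rigid_framework_def merged_verts_def bh_verts_def by auto
next
  case False
  let ?J = "{1..d+1}" and ?M = "edges H"
  have span: "affinely_spanning ?J (\<lambda>i. config x (Body v i))" if "v \<in> verts H" for v
    by (rule body_affinely_spanning[OF CARD x that])
  obtain u0 where u0: "u0 \<in> verts H" using False by blast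
  show ?thesis
  proof (rule globally_rigid_if_pinned[where p = "config x" and b = "Body u0" and c = 1, OF span[OF u0]])
    show "{Body u0 i, Body u0 j} \<in> merged_edges d H ?M"
      if "i \<in> ?J" "j \<in> ?J" "Body u0 i \<noteq> (Body u0 j :: ('v, 'e) bh_vertex)" for i j
      using body_edge[OF u0 that(1,2)] that(3) by auto
    fix q :: "('v, 'e) bh_vertex \<Rightarrow> real ^ 'd" and w
    assume q: "\<And>u v. {u, v} \<in> merged_edges d H ?M \<Longrightarrow> norm (q u - q v) = norm (config x u - config x v)"
      and q0: "\<And>i. i \<in> ?J \<Longrightarrow> q (Body u0 i) = config x (Body u0 i)"
      and w: "w \<in> merged_verts d H ?M"
    have q_body: "\<forall>i\<in>?J. q (Body v i) = config x (Body v i)" if v: "v \<in> verts H" for v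
      using conn[OF u0 v]
    proof (induction rule: rtrancl_induct)
      case (step y z)
      then obtain f where f: "f \<in> edges H" "ends H f = {y, z}" by auto
      have y: "y \<in> verts H" "y \<in> ends H f" "z \<in> ends H f" using f ends_subset by auto
      have "y \<noteq> z" using f ends_obtain[OF f(1)] by (metis doubleton_eq_iff)
      show ?case
      proof
        fix j assume j: "j \<in> ?J"
        show "q (Body z j) = config x (Body z j)"
        proof (rule eq_if_equidistant[OF span[OF y(1)]])
          fix i assume i: "i \<in> ?J"
          show "norm (q (Body z j) - config x (Body y i)) = norm (config x (Body z j) - config x (Body y i))"
            using q[OF merged_edge[OF f(1) y(3,2) j i]] step.IH i \<open>y \<noteq> z\<close> by auto
        qed
      qed
    qed (use q0 in auto)
    show "q w = config x w"
    proof (cases w)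
      case (Body v i)
      then show ?thesis using w q_body by (auto simp: merged_verts_def bh_verts_def)
    next
      case (Hinge f k)
      then have f: "f \<in> edges H" using w by (auto simp: merged_verts_def bh_verts_def)
      obtain v where v: "v \<in> ends H f" "v \<in> verts H" using ends_obtain[OF f] by auto
      show ?thesis
      proof (rule eq_if_equidistant[OF span[OF v(2)]])
        fix i assume i: "i \<in> ?J"
        have "norm (q (Body v i) - q w) = norm (config x (Body v i) - config x w)"
          using q[OF hinge_edge[OF f v(1) i]] w Hinge by auto
        then show "norm (q w - config x (Body v i)) = norm (config x w - config x (Body v i))"
          using q_body[OF v(2)] i by (simp add: norm_minus_commute)
      qed
    qed
  qed auto
qed

context
  fixes d D :: nat
  assumes d: "d \<ge> 2" and D: "D = (d + 1) choose 2"
begin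

text \<open>All bodies are placed at the same simplex.  For an edge \<open>{a, b}\<close> of the simplex the velocity
  of a body along \<open>ab\<close> at \<open>a\<close> equals the one at \<open>b\<close>, so two bodies sharing a hinge vertex at \<open>a\<close> or
  \<open>b\<close> agree in it; by connectedness of the tree of \<open>{a, b}\<close> all bodies agree.\<close>

lemma special_position_rigid:
  assumes CARD: "d = CARD('d::finite)" and M: "M \<subseteq> edges H" "e \<in> edges H" "e \<notin> M"
    and trees: "has_disjoint_spanning_trees D (multiply_edges (D - 1) (D - 3) H e)"
    and u0: "u0 \<in> verts H"
  shows "\<exists>s :: ('v, 'e) bh_vertex \<Rightarrow> real ^ 'd. \<forall>m. (\<forall>i\<in>{1..d+1}. m (Body u0 i) = 0) \<longrightarrow>
      (\<forall>u v. {u, v} \<in> merged_edges d H M \<and> u \<noteq> Hinge e 1 \<and> v \<noteq> Hinge e 1 \<longrightarrow>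
        (s u - s v) \<bullet> (m u - m v) = 0) \<longrightarrow> (\<forall>w\<in>merged_verts d H (insert e M). m w = 0)"
proof -
  let ?J = "{1..d+1}"
  obtain T pos where T: "\<And>P. P \<subseteq> ?J \<Longrightarrow> card P = 2 \<Longrightarrow>
        spanning_tree (multiply_edges (D - 1) (D - 3) H e) (T P)"
    and key: "\<And>P f j. P \<subseteq> ?J \<Longrightarrow> card P = 2 \<Longrightarrow> (f, j) \<in> T P \<Longrightarrow>
       \<exists>k\<in>{1..d-1}. (f = e \<longrightarrow> k \<noteq> 1) \<and> pos f k \<in> P"
    and pos: "\<And>f k. f \<in> edges H \<Longrightarrow> k \<in> {1..d-1} \<Longrightarrow> pos f k \<in> ?J"
    by (rule trees_indexed_by_simplex_edges[OF d D M(2) trees]) (rule that)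
  obtain s :: "nat \<Rightarrow> real ^ 'd" where s: "affinely_spanning ?J s"
    using affinely_spanning_simplex unfolding CARD by blast
  define S where "S = (\<lambda>w :: ('v, 'e) bh_vertex. case w of Body v i \<Rightarrow> s i | Hinge f k \<Rightarrow> s (pos f k))"
  show ?thesis
  proof (intro exI[of _ S] allI impI ballI)
    fix m :: "('v, 'e) bh_vertex \<Rightarrow> real ^ 'd" and w
    assume "\<forall>i\<in>?J. m (Body u0 i) = 0"
      and "\<forall>u v. {u, v} \<in> merged_edges d H M \<and> u \<noteq> Hinge e 1 \<and> v \<noteq> Hinge e 1 \<longrightarrow>
        (S u - S v) \<bullet> (m u - m v) = 0"
      and w: "w \<in> merged_verts d H (insert e M)"
    then have m0: "\<And>i. i \<in> ?J \<Longrightarrow> m (Body u0 i) = 0"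
      and m: "\<And>u v. {u, v} \<in> merged_edges d H M \<Longrightarrow> u \<noteq> Hinge e 1 \<Longrightarrow> v \<noteq> Hinge e 1 \<Longrightarrow>
        (S u - S v) \<bullet> (m u - m v) = 0"
      by blast+
    have body: "(s i - s j) \<bullet> m (Body v i) = (s i - s j) \<bullet> m (Body v j)"
      if "v \<in> verts H" "i \<in> ?J" "j \<in> ?J" for v i j
    proof (cases "i = j")
      case False
      then show ?thesis
        using m[OF body_edge[OF that False]] by (simp add: S_def inner_diff_right)
    qed simp
    \<comment> \<open>The hinge vertex coincides with vertex \<open>pos f k\<close> of each incident
      body. Its edges to the other vertices of the body make the difference of the two velocities
      orthogonal to spanning directions.\<close>
    have hinge: "m (Hinge f k) = m (Body v (pos f k))"
      if f: "f \<in> edges H" "v \<in> ends H f" "Hinge f k \<in> merged_verts d H (insert e M)" for f v k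
    proof -
      have hv: "Hinge f k \<in> merged_verts d H M" "Hinge f k \<noteq> Hinge e 1" and k: "k \<in> {1..d-1}"
        using f(3) by (auto simp: merged_verts_def bh_verts_def)
      have v: "v \<in> verts H" using ends_subset f by blast
      have "m (Body v (pos f k)) - m (Hinge f k) = 0"
      proof (rule affinely_spanningD[OF s pos[OF f(1) k]])
        fix i assume i: "i \<in> ?J"
        have "(s i - s (pos f k)) \<bullet> (m (Body v i) - m (Hinge f k)) = 0"
          using m[OF hinge_edge[OF f(1,2) i hv(1)]] hv(2) by (simp add: S_def)
        then show "(m (Body v (pos f k)) - m (Hinge f k)) \<bullet> (s i - s (pos f k)) = 0"
          using body[OF v i pos[OF f(1) k]]
          by (simp add: inner_diff_right inner_commute)
      qed
      then show ?thesis by simp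
    qed
    \<comment> \<open>Bodies merged along an edge of \<open>M\<close> move identically at every
      vertex, so trees may use such an edge although its first hinge vertex is gone.\<close>
    have merged: "m (Body u i) = m (Body v i)"
      if f: "f \<in> M" "u \<in> ends H f" "v \<in> ends H f" and i: "i \<in> ?J" for f u v i
    proof -
      have v: "v \<in> verts H" using ends_subset f M by blast
      have "m (Body u i) - m (Body v i) = 0"
      proof (rule affinely_spanningD[OF s i])
        fix j assume j: "j \<in> ?J"
        have "(s i - s j) \<bullet> (m (Body u i) - m (Body v j)) = 0"
          using m[OF merged_edge[OF f i j]] by (cases "i = j") (auto simp: S_def)
        moreover have "(s i - s j) \<bullet> (m (Body v i) - m (Body v j)) = 0"
          using body[OF v i j] by (simp add: inner_diff_right)
        ultimately have "(s i - s j) \<bullet> (m (Body u i) - m (Body v i)) = 0"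
          by (simp add: inner_diff_right)
        then show "(m (Body u i) - m (Body v i)) \<bullet> (s j - s i) = 0"
          by (simp add: inner_diff_right inner_diff_left inner_commute)
      qed
      then show ?thesis by simp
    qed
    \<comment> \<open>The directions from \<open>a\<close> to the other simplex vertices span the
      space; the component along each is handled by its own tree.\<close>
    have V: "m (Body v a) = 0" if v: "v \<in> verts H" and a: "a \<in> ?J" for v a
    proof (rule affinely_spanningD[OF s a])
      fix b assume b: "b \<in> ?J"
      show "m (Body v a) \<bullet> (s b - s a) = 0"
      proof (cases "a = b")
        case False
        let ?M = "multiply_edges (D - 1) (D - 3) H e"
        have P: "{a, b} \<subseteq> ?J" "card {a, b} = 2" using a b False by auto
        have tree: "T {a, b} \<subseteq> edges ?M" "connected_by ?M (T {a, b})"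
          using T[OF P] unfolding spanning_tree_def by auto
        have "(s b - s a) \<bullet> m (Body v a) = (s b - s a) \<bullet> m (Body u0 a)"
        proof (rule connected_by_constant[OF tree(2), where g = "\<lambda>v. (s b - s a) \<bullet> m (Body v a)"])
          fix t x y assume t: "t \<in> T {a, b}" "ends ?M t = {x, y}"
          obtain f j where fj: "t = (f, j)" by (cases t)
          then have f: "f \<in> edges H" "x \<in> ends H f" "y \<in> ends H f"
            using tree(1) t by (auto simp: multiply_edges_def)
          have xy: "x \<in> verts H" "y \<in> verts H" using f ends_subset by auto
          show "(s b - s a) \<bullet> m (Body x a) = (s b - s a) \<bullet> m (Body y a)"
          proof (cases "f \<in> M")
            case True
            then show ?thesis using merged[OF True f(2,3) a] by simp
          next
            case False
            obtain k where k: "k \<in> {1..d-1}" "f = e \<longrightarrow> k \<noteq> 1" "pos f k \<in> {a, b}"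
              using key[OF P] t(1) fj by blast
            then have "Hinge f k \<in> merged_verts d H (insert e M)"
              using False f(1) by (auto simp: merged_verts_def bh_verts_def)
            then have "m (Body x (pos f k)) = m (Body y (pos f k))"
              using hinge f by metis
            then show ?thesis
              using k(3) body[OF xy(1) b a] body[OF xy(2) b a] by auto
          qed
        qed (use v u0 in \<open>auto simp: multiply_edges_def\<close>)
        then show ?thesis using m0[OF a] by (simp add: inner_commute)
      qed simp
    qed
    show "m w = 0"
    proof (cases w)
      case (Body v i)
      then show ?thesis using V w by (auto simp: merged_verts_def bh_verts_def)
    next
      case (Hinge f k)
      then have f: "f \<in> edges H" "k \<in> {1..d-1}" using w by (auto simp: merged_verts_def bh_verts_def)
      obtain v where v: "v \<in> ends H f" "v \<in> verts H" using ends_obtain[OF f(1)] by auto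
      show ?thesis using hinge[OF f(1) v(1), of k] w Hinge V[OF v(2) pos[OF f]] by simp
    qed
  qed
qed

text \<open>Once the rest of the framework is fixed, the vertex \<open>Hinge e 1\<close> is chosen generically and off
  the bisecting hyperplanes of the finitely many pairs of positions that a vertex of the second body
  can take while the first body is kept fixed.  Equidistance of \<open>Hinge e 1\<close> then forces the second body
  to be in place.\<close>

lemma globally_rigid_step:
  fixes x :: "('v, 'e) bh_vertex \<times> 'd::finite \<Rightarrow> real"
  assumes CARD: "d = CARD('d)" and M: "M \<subseteq> edges H" "e \<in> edges H" "e \<notin> M"
    and trees: "has_disjoint_spanning_trees D (multiply_edges (D - 1) (D - 3) H e)"
    and x: "generic_point \<rat> (merged_verts d H (insert e M) \<times> UNIV) x"
    and rigid: "globally_rigid_framework (merged_verts d H (insert e M)) (merged_edges d H (insert e M)) (config x)"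
  obtains y :: "('v, 'e) bh_vertex \<times> 'd::finite \<Rightarrow> real" where
    "generic_point \<rat> (merged_verts d H M \<times> UNIV) y"
    "globally_rigid_framework (merged_verts d H M) (merged_edges d H M) (config y)"
proof -
  let ?J = "{1..d+1}"
  define h :: "('v, 'e) bh_vertex" where "h = Hinge e 1"
  define W where "W = merged_verts d H (insert e M)"
  have h: "h \<notin> W" "merged_verts d H M = insert h W"
    using d M by (auto simp: h_def W_def merged_verts_def bh_verts_def)
  have fin: "finite W" unfolding W_def by (rule finite_merged_verts)
  obtain u v where uv: "ends H e = {u, v}" "u \<noteq> v" "u \<in> verts H" "v \<in> verts H"
    by (rule ends_obtain[OF M(2)])
  define B :: "('v, 'e) bh_vertex set" where "B = Body u ` ?J"
  have BW: "B \<subseteq> W" using Body_in_merged_verts[OF uv(3)] unfolding B_def W_def by blast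
  have vW: "Body v i \<in> W" if "i \<in> ?J" for i using Body_in_merged_verts[OF uv(4) that] unfolding W_def .
  define E where "E = {(a, b). {a, b} \<in> merged_edges d H M \<and> a \<noteq> h \<and> b \<noteq> h}"
  have EW: "E \<subseteq> W \<times> W" using merged_edges_subset[OF M(1)] h(2) unfolding E_def by fastforce
  define C where "C = (\<lambda>w. {q w |q. (\<forall>w\<in>B. q w = config x w) \<and>
    (\<forall>(u, v)\<in>E. norm (q u - q v) = norm (config x u - config x v))})"
  from special_position_rigid[OF CARD M trees uv(3)]
  obtain s :: "('v, 'e) bh_vertex \<Rightarrow> real ^ 'd" where s: "\<forall>m. (\<forall>i\<in>?J. m (Body u i) = 0) \<longrightarrow>
      (\<forall>a b. {a, b} \<in> merged_edges d H M \<and> a \<noteq> Hinge e 1 \<and> b \<noteq> Hinge e 1 \<longrightarrow>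
        (s a - s b) \<bullet> (m a - m b) = 0) \<longrightarrow> (\<forall>w\<in>merged_verts d H (insert e M). m w = 0)"
    by (elim exE)
  have fin_C: "finite (C w)" if "w \<in> W" for w
    unfolding C_def
  proof (rule framework_finite_fibre[OF fin x[folded W_def] BW EW _ that])
    fix m :: "('v, 'e) bh_vertex \<Rightarrow> real ^ 'd" and w
    assume m: "\<And>w. w \<in> B \<Longrightarrow> m w = 0" "\<And>u v. (u, v) \<in> E \<Longrightarrow> (s u - s v) \<bullet> (m u - m v) = 0"
      and w: "w \<in> W"
    have "\<forall>i\<in>?J. m (Body u i) = 0" using m(1) by (simp add: B_def)
    moreover have "\<forall>a b. {a, b} \<in> merged_edges d H M \<and> a \<noteq> Hinge e 1 \<and> b \<noteq> Hinge e 1 \<longrightarrow>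
        (s a - s b) \<bullet> (m a - m b) = 0"
      using m(2) by (simp add: E_def h_def)
    ultimately show "m w = 0" using s w unfolding W_def by blast
  qed
  \<comment> \<open>All numbers in the equations of the bisecting hyperplanes: the actual
    coordinates and those of the finitely many alternatives.\<close>
  define L where "L = \<rat> \<union> x ` (W \<times> UNIV) \<union> (\<Union>w\<in>W. \<Union>a\<in>C w. range (\<lambda>k. a $ k))"
  have "countable L"
    unfolding L_def using fin fin_C by (intro countable_Un countable_UN) (auto intro: countable_finite countable_rat)
  moreover have "countable (W \<times> (UNIV :: 'd set))" "finite ({h} \<times> (UNIV :: 'd set))"
      "W \<times> (UNIV :: 'd set) \<inter> {h} \<times> UNIV = {}" "0 \<in> L" "1 \<in> L"
    using fin h(1) by (auto simp: L_def countable_finite)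
  ultimately obtain y where y: "\<And>i. i \<in> W \<times> UNIV \<Longrightarrow> y i = x i"
      "generic_point \<rat> (W \<times> UNIV \<union> {h} \<times> UNIV) y" "generic_point L ({h} \<times> UNIV) y"
    by (rule generic_point_extend_finite[OF countable_rat _ _ _ _ Rats_0 Rats_1 _ _ x[folded W_def]])
      (rule that)
  have cfg: "config y w = config x w" if "w \<in> W" for w using y(1) that by (simp add: vec_eq_iff)
  have gen_y: "generic_point \<rat> (merged_verts d H M \<times> UNIV) y"
  proof -
    have "merged_verts d H M \<times> (UNIV :: 'd set) = W \<times> UNIV \<union> {h} \<times> UNIV" unfolding h(2) by blast
    then show ?thesis using y(2) by simp
  qed
  have span: "affinely_spanning ?J (\<lambda>i. config y (Body u i))"
    by (rule body_affinely_spanning[OF CARD gen_y uv(3)])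
  have "globally_rigid_framework (merged_verts d H M) (merged_edges d H M) (config y)"
  proof (rule globally_rigid_if_pinned[where p = "config y" and b = "Body u" and c = 1, OF span])
    show "{Body u i, Body u j} \<in> merged_edges d H M"
      if "i \<in> ?J" "j \<in> ?J" "Body u i \<noteq> (Body u j :: ('v, 'e) bh_vertex)" for i j
      using body_edge[OF uv(3) that(1,2)] that(3) by auto
    fix q :: "('v, 'e) bh_vertex \<Rightarrow> real ^ 'd" and w
    assume q: "\<And>a b. {a, b} \<in> merged_edges d H M \<Longrightarrow> norm (q a - q b) = norm (config y a - config y b)"
      and qu: "\<And>i. i \<in> ?J \<Longrightarrow> q (Body u i) = config y (Body u i)"
      and w: "w \<in> merged_verts d H M"
    have uW: "Body u i \<in> W" if "i \<in> ?J" for i using BW that by (auto simp: B_def)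
    have "norm (q a - q b) = norm (config x a - config x b)" if "(a, b) \<in> E" for a b
    proof -
      have "a \<in> W" "b \<in> W" using that EW by auto
      then show ?thesis using q[of a b] that cfg unfolding E_def by simp
    qed
    then have qC: "q w \<in> C w" for w
      unfolding C_def using qu cfg uW by (intro CollectI exI[of _ q]) (auto simp: B_def)
    have hM: "Hinge e 1 \<in> merged_verts d H M" using h(2) by (simp add: h_def)
    have qh: "q h = config y h"
    proof (rule eq_if_equidistant[OF span])
      fix i assume i: "i \<in> ?J"
      show "norm (q h - config y (Body u i)) = norm (config y h - config y (Body u i))"
        using q[OF hinge_edge[OF M(2) _ i hM], of u] qu[OF i] uv(1)
        by (simp add: h_def norm_minus_commute)
    qed
    have qv: "q (Body v j) = config x (Body v j)" if j: "j \<in> ?J" for j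
    proof -
      define a where "a = q (Body v j)"
      define c where "c = config x (Body v j)"
      \<comment> \<open>Vanishes exactly when \<open>h\<close> is equidistant from \<open>a\<close>
        and \<open>c\<close>. Genericity of \<open>h\<close> over \<open>L\<close> makes it vanish
        identically, and its value at \<open>c\<close> is the squared distance of \<open>a\<close>
        and \<open>c\<close>.\<close>
      define g where "g = (\<lambda>z. \<Sum>k\<in>UNIV. (z (h, k) - a $ k)\<^sup>2 - (z (h, k) - c $ k)\<^sup>2 :: real)"
      have aL: "a $ k \<in> L" for k using qC[of "Body v j"] vW[OF j] unfolding L_def a_def by blast
      have cL: "c $ k \<in> L" for k using vW[OF j] unfolding L_def c_def by auto
      have m1: "-1 \<in> L" "0 \<in> L" "1 \<in> L" by (auto simp: L_def)
      have "g \<in> polys L ({h} \<times> UNIV)"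
        unfolding g_def using aL cL m1
        by (intro polys_sum polys_diff polys_power polys_var polys_const) auto
      moreover have "g y = 0"
      proof -
        have "norm (a - config y h) = norm (c - config y h)"
          using q[OF hinge_edge[OF M(2) _ j hM], of v] uv(1) qh cfg[OF vW[OF j]]
          by (simp add: h_def a_def c_def)
        then have "norm (config y h - a) = norm (config y h - c)" by (simp add: norm_minus_commute)
        then show ?thesis unfolding norm_eq_iff_inner
          by (simp add: g_def inner_vec_def sum_subtractf power2_eq_square)
      qed
      ultimately have "g (\<lambda>(w, k). c $ k) = 0" by (rule generic_pointD[OF y(3)])
      then have "(\<Sum>k\<in>UNIV. (c $ k - a $ k)\<^sup>2) = 0" by (simp add: g_def)
      then have "c $ k = a $ k" for k by (subst (asm) sum_nonneg_eq_0_iff) auto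
      then show ?thesis by (simp add: a_def c_def vec_eq_iff)
    qed
    have q': "norm (q a - q b) = norm (config x a - config x b)"
      if ab: "{a, b} \<in> merged_edges d H (insert e M)" for a b
    proof -
      have abW: "a \<in> W" "b \<in> W" using merged_edges_subset[OF _ ab] M by (auto simp: W_def)
      show ?thesis
      proof (cases "{a, b} \<in> merged_edges d H M")
        case True
        then show ?thesis using q[OF True] cfg abW by simp
      next
        case False
        \<comment> \<open>An edge that is not in the graph for \<open>M\<close> joins vertices of
          the two bodies at \<open>e\<close>, and these are already in place.\<close>
        have "{a, b} \<subseteq> merged_verts d H M" using abW h(2) by auto
        then have "{a, b} \<notin> bh_edges d H" using False unfolding merged_edges_def by blast
        then obtain u' v' i j f where f: "{a, b} = {Body u' i, Body v' j}" "f \<in> insert e M"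
            "u' \<in> ends H f" "v' \<in> ends H f" "i \<in> ?J" "j \<in> ?J" "u' \<noteq> v' \<or> i \<noteq> j"
          using ab unfolding merged_edges_def by blast
        have "f \<notin> M" using merged_edge[OF _ f(3-7), of M] f(1) False by auto
        then have "u' \<in> {u, v}" "v' \<in> {u, v}" using f(2-4) uv(1) by auto
        with f(1,5,6) have "q a = config x a" "q b = config x b"
          using qv qu cfg uW by (auto simp: doubleton_eq_iff)
        then show ?thesis by simp
      qed
    qed
    show "q w = config y w"
    proof (cases "w = h")
      case False
      then have wW: "w \<in> W" using w h(2) by auto
      show ?thesis
      proof (rule eq_if_equidistant[OF span])
        fix i assume i: "i \<in> ?J"
        have "norm (q w - q (Body u i)) = norm (config x w - config x (Body u i))"
          using rigid q' wW uW[OF i] unfolding globally_rigid_framework_def W_def by blast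
        then show "norm (q w - config y (Body u i)) = norm (config y w - config y (Body u i))"
          using qu[OF i] cfg wW uW[OF i] by simp
      qed
    qed (use qh in simp)
  qed auto
  then show ?thesis using that gen_y by blast
qed

end

end

theorem theorem5p2:
  fixes H :: "('v, 'e) multigraph"
    and d D :: nat
  assumes "d = CARD('d::finite)"
    and "d \<ge> 2"
    and "D = (d + 1) choose 2"
    and "finite_multigraph H"
    and "edges H \<noteq> {} \<or> card (verts H) \<le> 1"
    and "\<forall>e\<in>edges H. has_disjoint_spanning_trees D (multiply_edges (D - 1) (D - 3) H e)"
  shows "globally_rigid_graph TYPE('d) (bh_verts d H) (bh_edges d H)"
proof -
  have conn: "(u, v) \<in> {(x, y). \<exists>f\<in>edges H. ends H f = {x, y}}\<^sup>*"
    if uv: "u \<in> verts H" "v \<in> verts H" for u v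
  proof (cases "edges H = {}")
    case True
    then have "u = v"
      using assms(4,5) uv by (auto simp: finite_multigraph_def card_le_Suc0_iff_eq)
    then show ?thesis by simp
  next
    case False
    then obtain e where "e \<in> edges H" by blast
    moreover have "D > 0" using assms(2,3) by (simp add: zero_less_binomial_iff)
    ultimately obtain T where T: "spanning_tree (multiply_edges (D - 1) (D - 3) H e) T"
      using assms(6) unfolding has_disjoint_spanning_trees_def by blast
    then have "(u, v) \<in> {(x, y). \<exists>t\<in>T. ends (multiply_edges (D - 1) (D - 3) H e) t = {x, y}}\<^sup>*"
      using uv unfolding spanning_tree_def connected_by_def by (simp add: multiply_edges_def)
    moreover have "{(x, y). \<exists>t\<in>T. ends (multiply_edges (D - 1) (D - 3) H e) t = {x, y}}
        \<subseteq> {(x, y). \<exists>f\<in>edges H. ends H f = {x, y}}"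
      using T unfolding spanning_tree_def multiply_edges_def by fastforce
    ultimately show ?thesis using rtrancl_mono by blast
  qed
  \<comment> \<open>\<open>N\<close> is the set of edges whose first hinge vertex has been put back.
    The induction starts with all of them eliminated, because \<open>globally_rigid_step\<close>
    goes from \<open>insert e M\<close> to \<open>M\<close>.\<close>
  have "\<exists>x :: ('v, 'e) bh_vertex \<times> 'd \<Rightarrow> real.
      generic_point \<rat> (merged_verts d H (edges H - N) \<times> UNIV) x \<and>
      globally_rigid_framework (merged_verts d H (edges H - N)) (merged_edges d H (edges H - N)) (config x)"
    if "finite N" "N \<subseteq> edges H" for N
    using that
  proof (induction N rule: finite_induct)
    case empty
    have "finite (merged_verts d H (edges H))" by (rule finite_merged_verts[OF assms(4)])
    then have "finite (merged_verts d H (edges H) \<times> (UNIV :: 'd set))" by simp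
    then obtain x :: "('v, 'e) bh_vertex \<times> 'd \<Rightarrow> real"
      where x: "generic_point \<rat> (merged_verts d H (edges H) \<times> UNIV) x"
      by (rule generic_point_extend_finite[OF countable_rat countable_rat countable_empty _ _
            Rats_0 Rats_1 Rats_0 Rats_1 generic_point_empty]) auto
    show ?case
      using x globally_rigid_base[OF assms(4,1) x conn] by auto
  next
    case (insert e N)
    then obtain x :: "('v, 'e) bh_vertex \<times> 'd \<Rightarrow> real"
      where x: "generic_point \<rat> (merged_verts d H (edges H - N) \<times> UNIV) x"
        "globally_rigid_framework (merged_verts d H (edges H - N)) (merged_edges d H (edges H - N)) (config x)"
      by auto
    let ?M = "edges H - insert e N"
    have M: "edges H - N = insert e ?M" using insert by auto
    have e: "e \<in> edges H" using insert by auto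
    obtain y :: "('v, 'e) bh_vertex \<times> 'd \<Rightarrow> real" where
      "generic_point \<rat> (merged_verts d H ?M \<times> UNIV) y"
      "globally_rigid_framework (merged_verts d H ?M) (merged_edges d H ?M) (config y)"
      by (rule globally_rigid_step[OF assms(4,2,3,1) _ e _ _ x[unfolded M]])
        (use assms(6) e in auto)
    then show ?case by blast
  qed
  from this[of "edges H"] obtain x :: "('v, 'e) bh_vertex \<times> 'd \<Rightarrow> real" where
    x: "generic_point \<rat> (merged_verts d H {} \<times> UNIV) x"
      "globally_rigid_framework (merged_verts d H {}) (merged_edges d H {}) (config x)"
    using assms(4) by (auto simp: finite_multigraph_def)
  have "generic_realization (merged_verts d H {}) (config x)"
    by (rule generic_realization_of_generic_point[OF finite_merged_verts[OF assms(4)] x(1)])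
  moreover have "merged_verts d H {} = bh_verts d H" "merged_edges d H {} = bh_edges d H"
    using bh_edges_subset[OF assms(4)] by (auto simp: merged_verts_def merged_edges_def)
  ultimately show ?thesis
    using x(2) unfolding globally_rigid_graph_def by auto
qed

end
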